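(* Let $R$ be a general Krull ring. Then: (1) $T(R)$ is a zero-dimensional principal ideal ring. (2) $R$ satisfies the ascending chain condition on integral $u$-ideals. Hence, $R$ is a $u$-Noetherian ring.
   Context: All rings are commutative with nonzero identity. $T(R)$ is the total quotient ring of $R$; a regular element is a non-zero-divisor; an ideal is regular if it contains a regular element. For an $R$-submodule $I$ of $T(R)$, $I^{-1} = \{x \in T(R) : xI \subseteq R\}$. Let $\mathrm{rGV}(R)$ be the set of finitely generated regular ideals $J$ of $R$ with $J^{-1} = R$. For an $R$-submodule $I$ of $T(R)$, $I_u = \{x \in T(R) : xJ \subseteq I \text{ for some } J \in \mathrm{rGV}(R)\}$. An integral $u$-ideal is an ideal $I \subseteq R$ with $I_u = I$; $R$ is $u$-Noetherian if it satisfies the ascending chain condition on integral $u$-ideals. A special primary ring (SPR) is a local ring whose maximal ideal $M$ is principal and satisfies $M^n = (0)$ for some $n \geq 1$ (so a field is an SPR). A general Krull ring is a finite direct product of Krull domains and SPRs (a field counts as a Krull domain). A principal ideal ring is a ring all of whose ideals are principal. *)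

theory Defs
  imports "HOL-Algebra.Algebra" "HOL-Algebra.Chinese_Remainder" "HOL-Algebra.Ideal_Product"
    "HOL-Library.Extended_Nat"
begin

section \<open>The total quotient ring\<close>

definition regular_elements :: "('a, 'b) ring_scheme \<Rightarrow> 'a set" where
  "regular_elements R =
     {s \<in> carrier R. \<forall>a \<in> carrier R. a \<otimes>\<^bsub>R\<^esub> s = \<zero>\<^bsub>R\<^esub> \<longrightarrow> a = \<zero>\<^bsub>R\<^esub>}"

definition fraction_rel :: "('a, 'b) ring_scheme \<Rightarrow> (('a \<times> 'a) \<times> ('a \<times> 'a)) set" where
  "fraction_rel R = {((a, s), (b, t)).
     a \<in> carrier R \<and> b \<in> carrier R \<and> s \<in> regular_elements R \<and> t \<in> regular_elements R \<and>
     a \<otimes>\<^bsub>R\<^esub> t = b \<otimes>\<^bsub>R\<^esub> s}"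

text \<open>The fraction \<open>a/s\<close>.\<close>

definition fraction :: "('a, 'b) ring_scheme \<Rightarrow> 'a \<Rightarrow> 'a \<Rightarrow> ('a \<times> 'a) set" where
  "fraction R a s = fraction_rel R `` {(a, s)}"

definition total_quotient_ring :: "('a, 'b) ring_scheme \<Rightarrow> ('a \<times> 'a) set ring" where
  "total_quotient_ring R =
     \<lparr> carrier = (carrier R \<times> regular_elements R) // fraction_rel R,
       monoid.mult = (\<lambda>U V. \<Union>(a, s) \<in> U. \<Union>(b, t) \<in> V. fraction R (a \<otimes>\<^bsub>R\<^esub> b) (s \<otimes>\<^bsub>R\<^esub> t)),
       one = fraction R \<one>\<^bsub>R\<^esub> \<one>\<^bsub>R\<^esub>,
       ring.zero = fraction R \<zero>\<^bsub>R\<^esub> \<one>\<^bsub>R\<^esub>,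
       ring.add = (\<lambda>U V. \<Union>(a, s) \<in> U. \<Union>(b, t) \<in> V.
                fraction R (a \<otimes>\<^bsub>R\<^esub> t \<oplus>\<^bsub>R\<^esub> b \<otimes>\<^bsub>R\<^esub> s) (s \<otimes>\<^bsub>R\<^esub> t)) \<rparr>"

text \<open>The canonical embedding of \<open>R\<close> into its total quotient ring. A subset \<open>I\<close> of \<open>R\<close>,
  regarded as a subset of the total quotient ring, is \<open>to_tq R ` I\<close>.\<close>

definition to_tq :: "('a, 'b) ring_scheme \<Rightarrow> 'a \<Rightarrow> ('a \<times> 'a) set" where
  "to_tq R a = fraction R a \<one>\<^bsub>R\<^esub>"

section \<open>The \<open>u\<close>-operation\<close>

text \<open>In the next definition and in that of \<open>u_closure\<close>, \<open>I\<close> is a subset of the total quotient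
  ring; the definitions are meant for \<open>R\<close>-submodules.\<close>

definition inverse_module ::
    "('a, 'b) ring_scheme \<Rightarrow> ('a \<times> 'a) set set \<Rightarrow> ('a \<times> 'a) set set" where
  "inverse_module R I =
     {x \<in> carrier (total_quotient_ring R).
        \<forall>y \<in> I. x \<otimes>\<^bsub>total_quotient_ring R\<^esub> y \<in> to_tq R ` carrier R}"

definition rGV :: "('a, 'b) ring_scheme \<Rightarrow> 'a set set" where
  "rGV R = {J. ideal J R \<and> (\<exists>A \<subseteq> carrier R. finite A \<and> J = genideal R A) \<and>
               J \<inter> regular_elements R \<noteq> {} \<and>
               inverse_module R (to_tq R ` J) = to_tq R ` carrier R}"

definition u_closure ::
    "('a, 'b) ring_scheme \<Rightarrow> ('a \<times> 'a) set set \<Rightarrow> ('a \<times> 'a) set set" where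
  "u_closure R I =
     {x \<in> carrier (total_quotient_ring R).
        \<exists>J \<in> rGV R. \<forall>j \<in> J. x \<otimes>\<^bsub>total_quotient_ring R\<^esub> to_tq R j \<in> I}"

definition integral_u_ideal :: "('a, 'b) ring_scheme \<Rightarrow> 'a set \<Rightarrow> bool" where
  "integral_u_ideal R I \<longleftrightarrow> ideal I R \<and> u_closure R (to_tq R ` I) = to_tq R ` I"

definition acc_integral_u_ideals :: "('a, 'b) ring_scheme \<Rightarrow> bool" where
  "acc_integral_u_ideals R \<longleftrightarrow>
     (\<forall>I :: nat \<Rightarrow> 'a set.
        (\<forall>n. integral_u_ideal R (I n)) \<and> (\<forall>n. I n \<subseteq> I (Suc n)) \<longrightarrow>
        (\<exists>N. \<forall>n \<ge> N. I n = I N))"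

definition u_noetherian :: "('a, 'b) ring_scheme \<Rightarrow> bool" where
  "u_noetherian R \<longleftrightarrow> cring R \<and> \<one>\<^bsub>R\<^esub> \<noteq> \<zero>\<^bsub>R\<^esub> \<and> acc_integral_u_ideals R"

section \<open>Krull domains, special primary rings and general Krull rings\<close>

text \<open>A normalized discrete (rank one) valuation of the field \<open>K\<close>. The convention
  \<open>v 0 = \<infinity>\<close> is expressed by only constraining \<open>v\<close> on nonzero elements.\<close>

definition discrete_valuation :: "('k, 'm) ring_scheme \<Rightarrow> ('k \<Rightarrow> int) \<Rightarrow> bool" where
  "discrete_valuation K v \<longleftrightarrow>
     v ` (carrier K - {\<zero>\<^bsub>K\<^esub>}) = UNIV \<and>
     (\<forall>x \<in> carrier K - {\<zero>\<^bsub>K\<^esub>}. \<forall>y \<in> carrier K - {\<zero>\<^bsub>K\<^esub>}.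
        v (x \<otimes>\<^bsub>K\<^esub> y) = v x + v y \<and>
        (x \<oplus>\<^bsub>K\<^esub> y \<noteq> \<zero>\<^bsub>K\<^esub> \<longrightarrow> min (v x) (v y) \<le> v (x \<oplus>\<^bsub>K\<^esub> y)))"

text \<open>A Krull domain is the intersection of a family, of finite character, of discrete valuation
  rings of its quotient field. The family may be empty, which is the case of a field.\<close>

definition krull_domain :: "('a, 'b) ring_scheme \<Rightarrow> bool" where
  "krull_domain R \<longleftrightarrow> domain R \<and>
     (let K = total_quotient_ring R in
      \<exists>V. (\<forall>v \<in> V. discrete_valuation K v) \<and>
          to_tq R ` carrier R = {x \<in> carrier K. x = \<zero>\<^bsub>K\<^esub> \<or> (\<forall>v \<in> V. 0 \<le> v x)} \<and>
          (\<forall>x \<in> carrier K - {\<zero>\<^bsub>K\<^esub>}. finite {v \<in> V. v x \<noteq> 0}))"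

definition local_ring :: "('a, 'b) ring_scheme \<Rightarrow> bool" where
  "local_ring R \<longleftrightarrow> cring R \<and> (\<exists>!M. maximalideal M R)"

text \<open>Powers of an ideal are powers in the monoid \<open>ideals_set R\<close> of ideals of \<open>R\<close>.\<close>

definition special_primary_ring :: "('a, 'b) ring_scheme \<Rightarrow> bool" where
  "special_primary_ring R \<longleftrightarrow> local_ring R \<and>
     (\<forall>M. maximalideal M R \<longrightarrow>
        principalideal M R \<and> (\<exists>n :: nat. n \<ge> 1 \<and> M [^]\<^bsub>ideals_set R\<^esub> n = {\<zero>\<^bsub>R\<^esub>}))"

text \<open>Requiring the factors to have the same element type as \<open>R\<close> loses no generality: in a
  finite direct product, every factor is isomorphic to an ideal \<open>Re\<close> with \<open>e\<close> idempotent,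
  considered as a ring with identity \<open>e\<close>. The empty product is excluded, being the zero ring.\<close>

definition general_krull_ring :: "('a, 'b) ring_scheme \<Rightarrow> bool" where
  "general_krull_ring R \<longleftrightarrow> cring R \<and>
     (\<exists>Rs :: 'a ring list. Rs \<noteq> [] \<and>
        (\<forall>S \<in> set Rs. krull_domain S \<or> special_primary_ring S) \<and>
        R \<simeq> RDirProd_list Rs)"

section \<open>Krull dimension and principal ideal rings\<close>

text \<open>The supremum of the lengths \<open>n\<close> of chains \<open>P 0 \<subset> \<dots> \<subset> P n\<close> of prime ideals; the value
  is only meaningful for nonzero commutative rings.\<close>

definition krull_dim :: "('a, 'b) ring_scheme \<Rightarrow> enat" where
  "krull_dim R =
     (SUP n \<in> {n :: nat. \<exists>P :: nat \<Rightarrow> 'a set.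
                  (\<forall>i \<le> n. primeideal (P i) R) \<and> (\<forall>i < n. P i \<subset> P (Suc i))}. enat n)"

definition principal_ideal_ring :: "('a, 'b) ring_scheme \<Rightarrow> bool" where
  "principal_ideal_ring R \<longleftrightarrow> cring R \<and> \<one>\<^bsub>R\<^esub> \<noteq> \<zero>\<^bsub>R\<^esub> \<and> (\<forall>I. ideal I R \<longrightarrow> principalideal I R)"

end

theory Submission
  imports Defs
begin

text \<open>Both claims are reduced to statements inside \<open>R\<close> that pass to finite products componentwise.
  The total quotient ring is a zero-dimensional principal ideal ring as soon as every ideal \<open>J\<close> of
  \<open>R\<close> contains an element dividing a regular multiple of each element of \<open>J\<close>, and every \<open>a\<close>
  satisfies \<open>a\<^sup>n\<^sup>+\<^sup>1 | s a\<^sup>n\<close> for some regular \<open>s\<close> and some \<open>n\<close>. Special primary rings and domains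
  have both properties, and every ideal of a special primary ring is principal.

  In a Krull domain, a nonzero integral \<open>u\<close>-ideal \<open>I\<close> contains every \<open>x\<close> such that each defining
  valuation \<open>w\<close> has \<open>w i \<le> w x\<close> for some nonzero \<open>i \<in> I\<close>. Indeed, by finite character the ideal
  \<open>(I : x)\<close> has a finite subset \<open>F\<close> at which all valuations attain their minimum over \<open>(I : x)\<close>.
  If \<open>y = b/s\<close> satisfies \<open>y F \<subseteq> R\<close>, then \<open>y (I : x) \<subseteq> R\<close>; since \<open>I I\<^sup>-\<^sup>1 \<subseteq> (I : x)\<close>, it follows
  that \<open>y I\<^sup>-\<^sup>1 \<subseteq> I\<^sup>-\<^sup>1\<close>, so that all powers of \<open>y\<close> lie in \<open>I\<^sup>-\<^sup>1\<close> and \<open>y \<in> R\<close> by complete integral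
  closedness. Hence \<open>F\<close> generates an ideal in \<open>rGV R\<close> that multiplies \<open>x\<close> into \<open>I\<close>. The union of an
  ascending chain of integral \<open>u\<close>-ideals has a finite subset attaining all minimal values, and the
  chain is stationary from the first member containing that subset on.\<close>

section \<open>The total quotient ring\<close>

lemma regular_elementsD:
  assumes "s \<in> regular_elements R"
  shows "s \<in> carrier R" "\<And>a. a \<in> carrier R \<Longrightarrow> a \<otimes>\<^bsub>R\<^esub> s = \<zero>\<^bsub>R\<^esub> \<Longrightarrow> a = \<zero>\<^bsub>R\<^esub>"
  using assms by (auto simp: regular_elements_def)

context cring
begin

lemma regular_cancel:
  assumes "s \<in> regular_elements R" "a \<in> carrier R" "b \<in> carrier R" "a \<otimes> s = b \<otimes> s"
  shows "a = b"
proof -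
  have s: "s \<in> carrier R" using assms(1) by (rule regular_elementsD)
  have "(a \<ominus> b) \<otimes> s = \<zero>"
    using assms s by (simp add: minus_eq l_distr l_minus r_neg)
  then have "a \<ominus> b = \<zero>" using regular_elementsD(2)[OF assms(1), of "a \<ominus> b"] assms(2,3) by simp
  then show ?thesis using assms by simp
qed

lemma regular_one: "\<one> \<in> regular_elements R"
  by (auto simp: regular_elements_def)

lemma regular_mult:
  assumes "s \<in> regular_elements R" "t \<in> regular_elements R"
  shows "s \<otimes> t \<in> regular_elements R"
proof -
  have c: "s \<in> carrier R" "t \<in> carrier R" using assms by (auto dest: regular_elementsD)
  have "a = \<zero>" if "a \<in> carrier R" "a \<otimes> (s \<otimes> t) = \<zero>" for a
  proof -
    have "(a \<otimes> s) \<otimes> t = \<zero>" using that c by (simp add: m_assoc)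
    then have "a \<otimes> s = \<zero>" using regular_elementsD(2)[OF assms(2), of "a \<otimes> s"] that c by simp
    then show ?thesis using regular_elementsD(2)[OF assms(1)] that by blast
  qed
  then show ?thesis using c by (auto simp: regular_elements_def)
qed

text \<open>Transitivity is the only point with content: the two given equations yield
  \<open>(a u) t = (c s) t\<close>, and the middle denominator \<open>t\<close> cancels because it
  is regular.\<close>

lemma equiv_fraction_rel: "equiv (carrier R \<times> regular_elements R) (fraction_rel R)"
proof (rule equivI)
  show "fraction_rel R \<subseteq> (carrier R \<times> regular_elements R) \<times> (carrier R \<times> regular_elements R)"
    by (auto simp: fraction_rel_def)
  show "refl_on (carrier R \<times> regular_elements R) (fraction_rel R)"
    by (auto simp: refl_on_def fraction_rel_def)
  show "sym (fraction_rel R)"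
    by (auto simp: sym_def fraction_rel_def)
  show "trans (fraction_rel R)"
  proof (rule transI)
    fix x y z
    assume xy: "(x, y) \<in> fraction_rel R" and yz: "(y, z) \<in> fraction_rel R"
    obtain a s where x: "x = (a, s)" by fastforce
    obtain b t where y: "y = (b, t)" by fastforce
    obtain c u where z: "z = (c, u)" by fastforce
    have m: "a \<in> carrier R" "b \<in> carrier R" "c \<in> carrier R" "s \<in> regular_elements R"
      "t \<in> regular_elements R" "u \<in> regular_elements R"
      and e: "a \<otimes> t = b \<otimes> s" "b \<otimes> u = c \<otimes> t"
      using xy yz by (auto simp: x y z fraction_rel_def)
    have r: "s \<in> carrier R" "t \<in> carrier R" "u \<in> carrier R"
      using m by (auto dest: regular_elementsD)
    have "(a \<otimes> u) \<otimes> t = (a \<otimes> t) \<otimes> u" using m r by (simp add: m_ac)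
    also have "\<dots> = (b \<otimes> s) \<otimes> u" by (simp only: e)
    also have "\<dots> = (b \<otimes> u) \<otimes> s" using m r by (simp add: m_ac)
    also have "\<dots> = (c \<otimes> t) \<otimes> s" by (simp only: e)
    also have "\<dots> = (c \<otimes> s) \<otimes> t" using m r by (simp add: m_ac)
    finally have "a \<otimes> u = c \<otimes> s" using regular_cancel[of t "a \<otimes> u" "c \<otimes> s"] m r by simp
    then show "(x, z) \<in> fraction_rel R" using m by (auto simp: x z fraction_rel_def)
  qed
qed

lemma fraction_eq_iff:
  assumes "a \<in> carrier R" "s \<in> regular_elements R" "b \<in> carrier R" "t \<in> regular_elements R"
  shows "fraction R a s = fraction R b t \<longleftrightarrow> a \<otimes> t = b \<otimes> s"
  using eq_equiv_class_iff[OF equiv_fraction_rel, of "(a, s)" "(b, t)"] assms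
  by (auto simp: fraction_def fraction_rel_def)

lemma mem_fractionD:
  assumes "p \<in> fraction R a s"
  obtains b t where "p = (b, t)" "b \<in> carrier R" "t \<in> regular_elements R" "a \<otimes> t = b \<otimes> s"
  using assms by (auto simp: fraction_def fraction_rel_def)

lemma fraction_self:
  assumes "a \<in> carrier R" "s \<in> regular_elements R"
  shows "(a, s) \<in> fraction R a s"
  using assms by (auto simp: fraction_def fraction_rel_def)

section \<open>The ring structure on classes of fractions\<close>

abbreviation TQ where "TQ \<equiv> total_quotient_ring R"

lemma carrier_TQ: "carrier TQ = {fraction R a s | a s. a \<in> carrier R \<and> s \<in> regular_elements R}"
  by (auto simp: total_quotient_ring_def quotient_def fraction_def)

lemma fraction_closed:
  "a \<in> carrier R \<Longrightarrow> s \<in> regular_elements R \<Longrightarrow> fraction R a s \<in> carrier TQ"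
  by (auto simp: carrier_TQ)

lemma TQ_cases:
  assumes "x \<in> carrier TQ"
  obtains a s where "x = fraction R a s" "a \<in> carrier R" "s \<in> regular_elements R"
  using assms by (auto simp: carrier_TQ)

text \<open>Sum and product in \<open>TQ\<close> are unions over all pairs of representatives. If
  every pair gives the same class \<open>c\<close>, the union is constant and collapses to
  \<open>c\<close>; the index sets are nonempty by \<open>fraction_self\<close>. Well-definedness is
  thereby reduced to an identity in \<open>R\<close>.\<close>

lemma Union_fractions:
  assumes "a \<in> carrier R" "s \<in> regular_elements R" "b \<in> carrier R" "t \<in> regular_elements R"
    and "\<And>a' s' b' t'. \<lbrakk>a' \<in> carrier R; s' \<in> regular_elements R; b' \<in> carrier R;
           t' \<in> regular_elements R; a \<otimes> s' = a' \<otimes> s; b \<otimes> t' = b' \<otimes> t\<rbrakk> \<Longrightarrow> h a' s' b' t' = c"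
  shows "(\<Union>(a, s) \<in> fraction R a s. \<Union>(b, t) \<in> fraction R b t. h a s b t) = c"
proof -
  have "(\<Union>q \<in> fraction R b t. case q of (b', t') \<Rightarrow> h a' s' b' t') = c"
    if "a' \<in> carrier R" "s' \<in> regular_elements R" "a \<otimes> s' = a' \<otimes> s" for a' s'
  proof -
    have "(\<Union>q \<in> fraction R b t. case q of (b', t') \<Rightarrow> h a' s' b' t')
        = (\<Union>q \<in> fraction R b t. c)"
      using that by (intro SUP_cong refl) (auto elim!: mem_fractionD simp: assms(5))
    then show ?thesis using fraction_self[OF assms(3,4)] by auto
  qed
  then have "(\<Union>p \<in> fraction R a s. case p of (a', s') \<Rightarrow>
       \<Union>q \<in> fraction R b t. case q of (b', t') \<Rightarrow> h a' s' b' t') = (\<Union>p \<in> fraction R a s. c)"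
    by (intro SUP_cong refl) (erule mem_fractionD, simp only: prod.case)
  also have "\<dots> = c" using fraction_self[OF assms(1,2)] by auto
  finally show ?thesis .
qed

lemma fraction_mult:
  assumes "a \<in> carrier R" "s \<in> regular_elements R" "b \<in> carrier R" "t \<in> regular_elements R"
  shows "fraction R a s \<otimes>\<^bsub>TQ\<^esub> fraction R b t = fraction R (a \<otimes> b) (s \<otimes> t)"
proof -
  have "fraction R (a' \<otimes> b') (s' \<otimes> t') = fraction R (a \<otimes> b) (s \<otimes> t)"
    if h: "a' \<in> carrier R" "s' \<in> regular_elements R" "b' \<in> carrier R"
           "t' \<in> regular_elements R" "a \<otimes> s' = a' \<otimes> s" "b \<otimes> t' = b' \<otimes> t" for a' s' b' t'
  proof -
    have r: "s \<in> carrier R" "t \<in> carrier R" "s' \<in> carrier R" "t' \<in> carrier R"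
      using assms h by (auto dest: regular_elementsD)
    have "(a' \<otimes> b') \<otimes> (s \<otimes> t) = (a' \<otimes> s) \<otimes> (b' \<otimes> t)" using h r by (simp add: m_ac)
    also have "\<dots> = (a \<otimes> s') \<otimes> (b \<otimes> t')" using h by simp
    also have "\<dots> = (a \<otimes> b) \<otimes> (s' \<otimes> t')" using assms r by (simp add: m_ac)
    finally show ?thesis using assms h by (simp add: fraction_eq_iff regular_mult)
  qed
  then show ?thesis
    unfolding total_quotient_ring_def ring_record_simps monoid.simps
    by (intro Union_fractions assms)
qed

lemma fraction_add:
  assumes "a \<in> carrier R" "s \<in> regular_elements R" "b \<in> carrier R" "t \<in> regular_elements R"
  shows "fraction R a s \<oplus>\<^bsub>TQ\<^esub> fraction R b t = fraction R (a \<otimes> t \<oplus> b \<otimes> s) (s \<otimes> t)"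
proof -
  have "fraction R (a' \<otimes> t' \<oplus> b' \<otimes> s') (s' \<otimes> t') = fraction R (a \<otimes> t \<oplus> b \<otimes> s) (s \<otimes> t)"
    if h: "a' \<in> carrier R" "s' \<in> regular_elements R" "b' \<in> carrier R"
           "t' \<in> regular_elements R" "a \<otimes> s' = a' \<otimes> s" "b \<otimes> t' = b' \<otimes> t" for a' s' b' t'
  proof -
    have r: "s \<in> carrier R" "t \<in> carrier R" "s' \<in> carrier R" "t' \<in> carrier R"
      using assms h by (auto dest: regular_elementsD)
    have "(a' \<otimes> t' \<oplus> b' \<otimes> s') \<otimes> (s \<otimes> t)
        = (a' \<otimes> s) \<otimes> (t' \<otimes> t) \<oplus> (b' \<otimes> t) \<otimes> (s' \<otimes> s)" using h r by (simp add: m_ac l_distr r_distr)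
    also have "\<dots> = (a \<otimes> s') \<otimes> (t' \<otimes> t) \<oplus> (b \<otimes> t') \<otimes> (s' \<otimes> s)" using h by simp
    also have "\<dots> = (a \<otimes> t \<oplus> b \<otimes> s) \<otimes> (s' \<otimes> t')" using assms r by (simp add: m_ac l_distr r_distr)
    finally show ?thesis using assms h r
      by (simp add: fraction_eq_iff regular_mult regular_elementsD)
  qed
  then show ?thesis
    unfolding total_quotient_ring_def ring_record_simps monoid.simps
    by (intro Union_fractions assms)
qed

lemma TQ_one: "\<one>\<^bsub>TQ\<^esub> = fraction R \<one> \<one>"
  and TQ_zero: "\<zero>\<^bsub>TQ\<^esub> = fraction R \<zero> \<one>"
  by (simp_all add: total_quotient_ring_def)

lemma cring_TQ: "cring TQ"
proof (rule cringI)
  note fs = fraction_closed fraction_mult fraction_add fraction_eq_iff TQ_one TQ_zero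
    regular_mult regular_one regular_elementsD
  show "abelian_group TQ"
  proof (rule abelian_groupI)
    fix x y assume "x \<in> carrier TQ" "y \<in> carrier TQ"
    then show "x \<oplus>\<^bsub>TQ\<^esub> y \<in> carrier TQ"
      by (elim TQ_cases) (simp add: fs)
  next
    show "\<zero>\<^bsub>TQ\<^esub> \<in> carrier TQ" by (simp add: fs)
  next
    fix x y z assume "x \<in> carrier TQ" "y \<in> carrier TQ" "z \<in> carrier TQ"
    then show "x \<oplus>\<^bsub>TQ\<^esub> y \<oplus>\<^bsub>TQ\<^esub> z = x \<oplus>\<^bsub>TQ\<^esub> (y \<oplus>\<^bsub>TQ\<^esub> z)"
      by (elim TQ_cases) (simp add: fs l_distr r_distr m_ac a_ac)
  next
    fix x y assume "x \<in> carrier TQ" "y \<in> carrier TQ"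
    then show "x \<oplus>\<^bsub>TQ\<^esub> y = y \<oplus>\<^bsub>TQ\<^esub> x"
      by (elim TQ_cases) (simp add: fs m_ac a_ac)
  next
    fix x assume "x \<in> carrier TQ"
    then show "\<zero>\<^bsub>TQ\<^esub> \<oplus>\<^bsub>TQ\<^esub> x = x"
      by (elim TQ_cases) (simp add: fs)
  next
    fix x assume "x \<in> carrier TQ"
    then obtain a s where x: "x = fraction R a s" "a \<in> carrier R" "s \<in> regular_elements R"
      by (rule TQ_cases)
    have "fraction R (\<ominus> a) s \<oplus>\<^bsub>TQ\<^esub> x = \<zero>\<^bsub>TQ\<^esub>"
      using x by (simp add: fs l_minus l_neg)
    moreover have "fraction R (\<ominus> a) s \<in> carrier TQ" using x by (simp add: fs)
    ultimately show "\<exists>y\<in>carrier TQ. y \<oplus>\<^bsub>TQ\<^esub> x = \<zero>\<^bsub>TQ\<^esub>" by blast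
  qed
  show "comm_monoid TQ"
  proof (rule comm_monoidI)
    fix x y assume "x \<in> carrier TQ" "y \<in> carrier TQ"
    then show "x \<otimes>\<^bsub>TQ\<^esub> y \<in> carrier TQ"
      by (elim TQ_cases) (simp add: fs)
  next
    show "\<one>\<^bsub>TQ\<^esub> \<in> carrier TQ" by (simp add: fs)
  next
    fix x y z assume "x \<in> carrier TQ" "y \<in> carrier TQ" "z \<in> carrier TQ"
    then show "x \<otimes>\<^bsub>TQ\<^esub> y \<otimes>\<^bsub>TQ\<^esub> z = x \<otimes>\<^bsub>TQ\<^esub> (y \<otimes>\<^bsub>TQ\<^esub> z)"
      by (elim TQ_cases) (simp add: fs m_ac)
  next
    fix x assume "x \<in> carrier TQ"
    then show "\<one>\<^bsub>TQ\<^esub> \<otimes>\<^bsub>TQ\<^esub> x = x"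
      by (elim TQ_cases) (simp add: fs)
  next
    fix x y assume "x \<in> carrier TQ" "y \<in> carrier TQ"
    then show "x \<otimes>\<^bsub>TQ\<^esub> y = y \<otimes>\<^bsub>TQ\<^esub> x"
      by (elim TQ_cases) (simp add: fs m_ac)
  qed
  fix x y z assume "x \<in> carrier TQ" "y \<in> carrier TQ" "z \<in> carrier TQ"
  then show "(x \<oplus>\<^bsub>TQ\<^esub> y) \<otimes>\<^bsub>TQ\<^esub> z = x \<otimes>\<^bsub>TQ\<^esub> z \<oplus>\<^bsub>TQ\<^esub> y \<otimes>\<^bsub>TQ\<^esub> z"
    by (elim TQ_cases) (simp add: fs l_distr r_distr m_ac)
qed

section \<open>The embedding of \<open>R\<close> into \<open>T(R)\<close>\<close>

lemma to_tq_hom: "to_tq R \<in> ring_hom R TQ"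
  by (rule ring_hom_memI)
    (simp_all add: to_tq_def fraction_closed fraction_mult fraction_add TQ_one regular_one)

lemma to_tq_closed: "a \<in> carrier R \<Longrightarrow> to_tq R a \<in> carrier TQ"
  using to_tq_hom by (rule ring_hom_closed)

lemma to_tq_eq_iff:
  "a \<in> carrier R \<Longrightarrow> b \<in> carrier R \<Longrightarrow> to_tq R a = to_tq R b \<longleftrightarrow> a = b"
  by (simp add: to_tq_def fraction_eq_iff regular_one)

lemma to_tq_mem_image_iff:
  assumes "a \<in> carrier R" "I \<subseteq> carrier R"
  shows "to_tq R a \<in> to_tq R ` I \<longleftrightarrow> a \<in> I"
  using assms by (auto simp: to_tq_eq_iff subset_iff image_iff)

lemma fraction_mult_to_tq:
  assumes "a \<in> carrier R" "s \<in> regular_elements R" "b \<in> carrier R"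
  shows "fraction R a s \<otimes>\<^bsub>TQ\<^esub> to_tq R b = fraction R (a \<otimes> b) s"
  using assms by (simp add: to_tq_def fraction_mult regular_one regular_elementsD)

lemma fraction_mult_denominator:
  assumes "a \<in> carrier R" "s \<in> regular_elements R"
  shows "fraction R a s \<otimes>\<^bsub>TQ\<^esub> to_tq R s = to_tq R a"
  using assms by (simp add: fraction_mult_to_tq regular_elementsD)
    (simp add: to_tq_def fraction_eq_iff regular_one regular_elementsD)

text \<open>This is the bridge from \<open>T(R)\<close> to divisibility in \<open>R\<close>: both
  inverses of ideals and the valuation description of a Krull domain are translated by it.\<close>

lemma fraction_in_image_iff:
  assumes "a \<in> carrier R" "s \<in> regular_elements R"
  shows "fraction R a s \<in> to_tq R ` carrier R \<longleftrightarrow> s divides a"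
  using assms
  by (auto simp: to_tq_def image_iff fraction_eq_iff regular_one regular_elementsD factor_def m_comm
      intro!: bexI)

end

section \<open>Conditions on the base ring\<close>

text \<open>Over \<open>T(R)\<close>, where \<open>s\<close> is a unit, the divisibility says that
  \<open>b\<close> is a multiple of \<open>a\<close>. So the extension of \<open>J\<close> to
  \<open>T(R)\<close> is generated by an element of \<open>J\<close> itself.\<close>

definition regularly_principal :: "('a, 'b) ring_scheme \<Rightarrow> bool" where
  "regularly_principal R \<longleftrightarrow>
     (\<forall>J. ideal J R \<longrightarrow>
        (\<exists>a \<in> J. \<forall>b \<in> J. \<exists>s \<in> regular_elements R. a divides\<^bsub>R\<^esub> s \<otimes>\<^bsub>R\<^esub> b))"

text \<open>This is pi-regularity of the elements of \<open>R\<close> inside \<open>T(R)\<close>,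
  with the denominator cleared: \<open>a^n = a^(n+1) y\<close> for some
  \<open>y = c/s\<close>.\<close>

definition regularly_pi_regular :: "('a, 'b) ring_scheme \<Rightarrow> bool" where
  "regularly_pi_regular R \<longleftrightarrow>
     (\<forall>a \<in> carrier R. \<exists>n :: nat. \<exists>s \<in> regular_elements R.
        a [^]\<^bsub>R\<^esub> Suc n divides\<^bsub>R\<^esub> s \<otimes>\<^bsub>R\<^esub> a [^]\<^bsub>R\<^esub> n)"

text \<open>A finite set of generators, one of them regular, of an ideal in \<open>rGV R\<close>; the last clause says
  that \<open>a/s \<in> R\<close> whenever \<open>a/s\<close> multiplies \<open>F\<close> into \<open>R\<close>.\<close>

definition GV_set :: "('a, 'b) ring_scheme \<Rightarrow> 'a set \<Rightarrow> bool" where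
  "GV_set R F \<longleftrightarrow> finite F \<and> F \<subseteq> carrier R \<and> F \<inter> regular_elements R \<noteq> {} \<and>
     (\<forall>a \<in> carrier R. \<forall>s \<in> regular_elements R.
        (\<forall>j \<in> F. s divides\<^bsub>R\<^esub> a \<otimes>\<^bsub>R\<^esub> j) \<longrightarrow> s divides\<^bsub>R\<^esub> a)"

text \<open>Closedness is tested on finite generating sets and only for \<open>x\<close> in
  \<open>R\<close>, so that no fraction occurs and the notion passes to the factors of a product.
  Every integral \<open>u\<close>-ideal has this property, so the chain condition below is at least
  as strong as the one wanted.\<close>

definition u_closed_ideal :: "('a, 'b) ring_scheme \<Rightarrow> 'a set \<Rightarrow> bool" where
  "u_closed_ideal R I \<longleftrightarrow> ideal I R \<and>
     (\<forall>F x. GV_set R F \<and> x \<in> carrier R \<and> (\<forall>j \<in> F. x \<otimes>\<^bsub>R\<^esub> j \<in> I) \<longrightarrow> x \<in> I)"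

definition acc_u_closed_ideals :: "('a, 'b) ring_scheme \<Rightarrow> bool" where
  "acc_u_closed_ideals R \<longleftrightarrow>
     (\<forall>I :: nat \<Rightarrow> 'a set.
        (\<forall>n. u_closed_ideal R (I n)) \<and> (\<forall>n. I n \<subseteq> I (Suc n)) \<longrightarrow>
        (\<exists>N. \<forall>n \<ge> N. I n = I N))"

context cring
begin

section \<open>Ideals and primes of \<open>T(R)\<close>\<close>

lemma ideal_to_tq_vimage:
  assumes "ideal I TQ"
  shows "ideal {a \<in> carrier R. to_tq R a \<in> I} R"
proof -
  interpret T: cring TQ by (rule cring_TQ)
  interpret h: ring_hom_ring R TQ "to_tq R"
    by (rule ring_hom_ringI2) (rule ring_axioms T.ring_axioms to_tq_hom)+
  show ?thesis using h.ideal_vimage[OF assms] .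
qed

text \<open>Denominators are units of \<open>T(R)\<close>, so an ideal \<open>I\<close> is generated
  by the numerators it contains. Those form an ideal of \<open>R\<close>, and the element
  \<open>a\<close> that the hypothesis provides for it generates \<open>I\<close>.\<close>

lemma principal_ideal_ring_TQ:
  assumes "\<one> \<noteq> \<zero>" "regularly_principal R"
  shows "principal_ideal_ring TQ"
  unfolding principal_ideal_ring_def
proof (intro conjI allI impI)
  interpret T: cring TQ by (rule cring_TQ)
  show "cring TQ" by (rule cring_TQ)
  show "\<one>\<^bsub>TQ\<^esub> \<noteq> \<zero>\<^bsub>TQ\<^esub>"
    using assms(1) by (simp add: TQ_one TQ_zero fraction_eq_iff regular_one)
  fix I assume I: "ideal I TQ"
  interpret I: ideal I TQ by (rule I)
  obtain a where a: "a \<in> carrier R" "to_tq R a \<in> I"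
    and dvd: "\<And>b. b \<in> carrier R \<Longrightarrow> to_tq R b \<in> I \<Longrightarrow>
      \<exists>s \<in> regular_elements R. a divides s \<otimes> b"
    using assms(2) ideal_to_tq_vimage[OF I] unfolding regularly_principal_def by blast
  have "I = PIdl\<^bsub>TQ\<^esub> (to_tq R a)"
  proof
    show "PIdl\<^bsub>TQ\<^esub> (to_tq R a) \<subseteq> I" using T.cgenideal_minimal[OF I a(2)] .
    show "I \<subseteq> PIdl\<^bsub>TQ\<^esub> (to_tq R a)"
    proof
      fix x assume x: "x \<in> I"
      then obtain b t where b: "x = fraction R b t" "b \<in> carrier R" "t \<in> regular_elements R"
        using TQ_cases[of x] I.Icarr by metis
      then have "to_tq R b \<in> I"
        using I.I_r_closed[OF x, of "to_tq R t"]
        by (simp add: fraction_mult_denominator to_tq_closed regular_elementsD)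
      then obtain s c where s: "s \<in> regular_elements R" "c \<in> carrier R" "s \<otimes> b = a \<otimes> c"
        using dvd[OF b(2)] by (auto simp: factor_def)
      have r: "s \<in> carrier R" "t \<in> carrier R" using s b by (auto dest: regular_elementsD)
      have "b \<otimes> (s \<otimes> t) = (s \<otimes> b) \<otimes> t" using b r by (simp add: m_ac)
      also have "\<dots> = (c \<otimes> a) \<otimes> t" using s a by (simp add: m_comm)
      \<comment> \<open>From \<open>s b = a c\<close> one reads off
        \<open>b/t = (c/(s t)) a\<close>.\<close>
      finally have "x = fraction R c (s \<otimes> t) \<otimes>\<^bsub>TQ\<^esub> to_tq R a"
        using s b a by (simp add: fraction_mult_to_tq fraction_eq_iff regular_mult)
      then show "x \<in> PIdl\<^bsub>TQ\<^esub> (to_tq R a)"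
        using s b by (auto simp: cgenideal_def intro!: fraction_closed regular_mult)
    qed
  qed
  then show "principalideal I TQ"
    using T.cgenideal_is_principalideal to_tq_closed[OF a(1)] by simp
qed

text \<open>If \<open>a\<close> lies in \<open>Q\<close> but not in \<open>P\<close>, then
  \<open>a^n (s - a c) = 0\<close> puts \<open>s - a c\<close> into \<open>P\<close>, hence
  \<open>s\<close> into \<open>Q\<close>. But \<open>s\<close> is a unit of
  \<open>T(R)\<close>.\<close>

lemma primeideal_TQ_maximal:
  assumes "regularly_pi_regular R" "primeideal P TQ" "primeideal Q TQ" "P \<subseteq> Q"
  shows "P = Q"
proof (rule ccontr)
  interpret T: cring TQ by (rule cring_TQ)
  interpret h: ring_hom_ring R TQ "to_tq R"
    by (rule ring_hom_ringI2) (rule ring_axioms T.ring_axioms to_tq_hom)+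
  interpret P: primeideal P TQ by fact
  interpret Q: primeideal Q TQ by fact
  assume "P \<noteq> Q"
  then obtain x where x: "x \<in> Q" "x \<notin> P" using assms(4) by auto
  then obtain a t where a: "x = fraction R a t" "a \<in> carrier R" "t \<in> regular_elements R"
    using TQ_cases[of x] Q.Icarr by metis
  have aQ: "to_tq R a \<in> Q"
    using Q.I_r_closed[OF x(1), of "to_tq R t"] a
    by (simp add: fraction_mult_denominator to_tq_closed regular_elementsD)
  \<comment> \<open>\<open>x\<close> and its numerator \<open>a\<close> differ by the unit
    \<open>1/t\<close>, so \<open>a\<close> avoids \<open>P\<close> together with
    \<open>x\<close>.\<close>
  have xa: "fraction R \<one> t \<otimes>\<^bsub>TQ\<^esub> to_tq R a = x"
    using a by (simp add: fraction_mult_to_tq)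
  have aP: "to_tq R a \<notin> P"
    using P.I_l_closed[of "to_tq R a" "fraction R \<one> t"] x(2) a xa by (auto simp: fraction_closed)
  obtain n :: nat and s c where s: "s \<in> regular_elements R" "c \<in> carrier R"
    and e: "s \<otimes> a [^] n = a [^] Suc n \<otimes> c"
    using assms(1) a(2) unfolding regularly_pi_regular_def factor_def by blast
  have sc: "s \<in> carrier R" using s by (rule_tac regular_elementsD)
  \<comment> \<open>The exponent \<open>n\<close> may be 0; the power \<open>a^0 = 1\<close> avoids
    \<open>P\<close> because \<open>P\<close> is proper.\<close>
  have nP: "to_tq R (a [^] m) \<notin> P" for m :: nat
  proof (induction m)
    case 0
    show ?case
      using P.I_notcarr P.one_imp_carrier by auto
  next
    case (Suc m)
    then show ?case using P.I_prime[of "to_tq R (a [^] m)" "to_tq R a"] aP a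
      by (auto simp: to_tq_closed)
  qed
  have "a [^] n \<otimes> (s \<ominus> a \<otimes> c) = s \<otimes> a [^] n \<ominus> a [^] Suc n \<otimes> c"
    using a sc s(2) by (simp add: minus_eq r_distr r_minus m_ac)
  also have "\<dots> = \<zero>" using e a sc s(2) by (simp add: r_neg minus_eq)
  finally have "to_tq R (a [^] n) \<otimes>\<^bsub>TQ\<^esub> to_tq R (s \<ominus> a \<otimes> c) = \<zero>\<^bsub>TQ\<^esub>"
    using a sc s(2) by (simp flip: h.hom_mult)
  then have "to_tq R (s \<ominus> a \<otimes> c) \<in> P"
    using P.I_prime[of "to_tq R (a [^] n)" "to_tq R (s \<ominus> a \<otimes> c)"] nP a sc s(2)
    by (auto simp: to_tq_closed simp del: h.hom_mult)
  then have "to_tq R (s \<ominus> a \<otimes> c) \<oplus>\<^bsub>TQ\<^esub> to_tq R a \<otimes>\<^bsub>TQ\<^esub> to_tq R c \<in> Q"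
    using assms(4) aQ s(2) by (intro Q.a_closed Q.I_r_closed) (auto simp: to_tq_closed)
  moreover have "s \<ominus> a \<otimes> c \<oplus> a \<otimes> c = s"
    using a sc s(2) by (simp add: minus_eq a_assoc l_neg)
  ultimately have "to_tq R s \<in> Q"
    using a sc s(2) by (simp flip: h.hom_mult h.hom_add)
  then have "fraction R \<one> s \<otimes>\<^bsub>TQ\<^esub> to_tq R s \<in> Q"
    using s by (intro Q.I_l_closed) (auto simp: fraction_closed)
  then have "\<one>\<^bsub>TQ\<^esub> \<in> Q"
    using s by (simp add: fraction_mult_denominator)
  then show False using Q.one_imp_carrier Q.I_notcarr by auto
qed

lemma krull_dim_TQ:
  assumes "regularly_pi_regular R"
  shows "krull_dim TQ = 0"
proof -
  have "n = 0" if "\<forall>i \<le> n. primeideal (P i) TQ" "\<forall>i < n. P i \<subset> P (Suc i)" for n P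
  proof (rule ccontr)
    assume "n \<noteq> 0"
    then have "primeideal (P 0) TQ" "primeideal (P (Suc 0)) TQ" "P 0 \<subset> P (Suc 0)"
      using that by auto
    then show False using primeideal_TQ_maximal[OF assms] by blast
  qed
  then have "krull_dim TQ \<le> 0"
    unfolding krull_dim_def by (intro SUP_least) (auto simp: zero_enat_def)
  then show ?thesis by simp
qed

section \<open>Finite generating sets and integral \<open>u\<close>-ideals\<close>

lemma genideal_finite_rGV:
  assumes "GV_set R F"
  shows "Idl F \<in> rGV R"
proof -
  have F: "finite F" "F \<subseteq> carrier R" "F \<inter> regular_elements R \<noteq> {}"
    and dvd: "\<And>a s. a \<in> carrier R \<Longrightarrow> s \<in> regular_elements R \<Longrightarrow>
      (\<And>j. j \<in> F \<Longrightarrow> s divides a \<otimes> j) \<Longrightarrow> s divides a"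
    using assms by (auto simp: GV_set_def)
  have i: "ideal (Idl F) R" by (rule genideal_ideal[OF F(2)])
  have sub: "F \<subseteq> Idl F" by (rule genideal_self[OF F(2)])
  have "inverse_module R (to_tq R ` (Idl F)) = to_tq R ` carrier R"
  proof
    show "inverse_module R (to_tq R ` (Idl F)) \<subseteq> to_tq R ` carrier R"
    proof
      fix x assume "x \<in> inverse_module R (to_tq R ` (Idl F))"
      then have x: "x \<in> carrier TQ"
        and m: "\<And>j. j \<in> F \<Longrightarrow> x \<otimes>\<^bsub>TQ\<^esub> to_tq R j \<in> to_tq R ` carrier R"
        using sub by (auto simp: inverse_module_def)
      obtain a s where a: "x = fraction R a s" "a \<in> carrier R" "s \<in> regular_elements R"
        using x by (rule TQ_cases)
      have "s divides a \<otimes> j" if "j \<in> F" for j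
      proof -
        have "j \<in> carrier R" using that F by auto
        then show ?thesis
          using m[OF that] a by (simp add: fraction_mult_to_tq fraction_in_image_iff)
      qed
      then have "s divides a" by (rule dvd[OF a(2,3)])
      then show "x \<in> to_tq R ` carrier R" using a by (simp add: fraction_in_image_iff)
    qed
    show "to_tq R ` carrier R \<subseteq> inverse_module R (to_tq R ` (Idl F))"
      using ideal.Icarr[OF i] ring_hom_mult[OF to_tq_hom, symmetric]
      by (auto simp: inverse_module_def to_tq_closed)
  qed
  then show ?thesis using F i sub unfolding rGV_def by blast
qed

lemma integral_u_ideal_imp_u_closed:
  assumes "integral_u_ideal R I"
  shows "u_closed_ideal R I"
  unfolding u_closed_ideal_def
proof (intro conjI allI impI)
  show I: "ideal I R" using assms by (simp add: integral_u_ideal_def)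
  interpret I: ideal I R by (rule I)
  fix F x
  assume "GV_set R F \<and> x \<in> carrier R \<and> (\<forall>j \<in> F. x \<otimes> j \<in> I)"
  then have F: "GV_set R F" and x: "x \<in> carrier R" and xF: "\<forall>j \<in> F. x \<otimes> j \<in> I" by auto
  have Fc: "F \<subseteq> carrier R" using F by (simp add: GV_set_def)
  \<comment> \<open>The right-hand side is the ideal \<open>(I : x)\<close>; it contains
    \<open>F\<close> and hence the ideal generated by \<open>F\<close>.\<close>
  have "Idl F \<subseteq> {j \<in> carrier R. x \<otimes> j \<in> I}"
    using xF Fc by (intro genideal_minimal I.helper_max_prime[OF is_cring x]) auto
  then have "to_tq R x \<otimes>\<^bsub>TQ\<^esub> to_tq R j \<in> to_tq R ` I" if "j \<in> Idl F" for j
    using that x by (auto simp flip: ring_hom_mult[OF to_tq_hom])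
  then have "to_tq R x \<in> u_closure R (to_tq R ` I)"
    using genideal_finite_rGV[OF F] x by (auto simp: u_closure_def to_tq_closed)
  then have "to_tq R x \<in> to_tq R ` I" using assms by (simp add: integral_u_ideal_def)
  then show "x \<in> I" using x I.a_subset by (simp add: to_tq_mem_image_iff)
qed

lemma acc_integral_u_ideals_of_u_closed:
  "acc_u_closed_ideals R \<Longrightarrow> acc_integral_u_ideals R"
  unfolding acc_u_closed_ideals_def acc_integral_u_ideals_def
  using integral_u_ideal_imp_u_closed by blast

end

section \<open>Products of two rings\<close>

lemma u_closed_idealD:
  assumes "u_closed_ideal R I"
  shows "ideal I R"
    "\<And>F x. \<lbrakk>GV_set R F; x \<in> carrier R; \<And>j. j \<in> F \<Longrightarrow> x \<otimes>\<^bsub>R\<^esub> j \<in> I\<rbrakk> \<Longrightarrow> x \<in> I"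
  using assms unfolding u_closed_ideal_def by blast+

text \<open>The map \<open>x \<mapsto> (f x, g x)\<close> identifies \<open>R\<close> with \<open>A \<times> B\<close>.\<close>

locale ring_product =
  cring R + A: cring A + B: cring B + f: ring_hom_cring R A f + g: ring_hom_cring R B g
  for R (structure) and A :: "('c, 'd) ring_scheme" and B :: "('e, 'f) ring_scheme" and f g +
  assumes surj: "a \<in> carrier A \<Longrightarrow> b \<in> carrier B \<Longrightarrow> \<exists>x \<in> carrier R. f x = a \<and> g x = b"
    and inj: "x \<in> carrier R \<Longrightarrow> y \<in> carrier R \<Longrightarrow> f x = f y \<Longrightarrow> g x = g y \<Longrightarrow> x = y"
begin

text \<open>The factors play symmetric roles; this lets each result about \<open>f\<close> and
  \<open>A\<close> be reused for \<open>g\<close> and \<open>B\<close>.\<close>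

lemma swap: "ring_product R B A g f"
  by unfold_locales (use surj inj in blast)+

lemma obtain_preimage:
  assumes "a \<in> carrier A" "b \<in> carrier B"
  obtains x where "x \<in> carrier R" "f x = a" "g x = b"
  using surj[OF assms] by blast

lemma regular_fst:
  assumes "s \<in> regular_elements R"
  shows "f s \<in> regular_elements A"
proof -
  have s: "s \<in> carrier R" using assms by (rule regular_elementsD)
  have "a = \<zero>\<^bsub>A\<^esub>" if a: "a \<in> carrier A" "a \<otimes>\<^bsub>A\<^esub> f s = \<zero>\<^bsub>A\<^esub>" for a
  proof -
    \<comment> \<open>\<open>x\<close> stands for the pair \<open>(a, 0)\<close>, so
      \<open>x s = 0\<close> already follows from \<open>a (f s) = 0\<close>.\<close>
    obtain x where x: "x \<in> carrier R" "f x = a" "g x = \<zero>\<^bsub>B\<^esub>"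
      using a by (auto elim: obtain_preimage[of a "\<zero>\<^bsub>B\<^esub>"])
    have "x \<otimes> s = \<zero>" using x a s by (intro inj) auto
    then have "x = \<zero>" using regular_elementsD(2)[OF assms] x by blast
    then show ?thesis using x by simp
  qed
  then show ?thesis using s by (auto simp: regular_elements_def)
qed

lemma regular_iff:
  assumes "s \<in> carrier R"
  shows "s \<in> regular_elements R \<longleftrightarrow> f s \<in> regular_elements A \<and> g s \<in> regular_elements B"
proof (intro iffI conjI)
  assume s: "s \<in> regular_elements R"
  show "f s \<in> regular_elements A" using s by (rule regular_fst)
  show "g s \<in> regular_elements B" using s by (rule ring_product.regular_fst[OF swap])
next
  assume fg: "f s \<in> regular_elements A \<and> g s \<in> regular_elements B"
  have "x = \<zero>" if x: "x \<in> carrier R" "x \<otimes> s = \<zero>" for x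
  proof (rule inj)
    have "f x \<otimes>\<^bsub>A\<^esub> f s = \<zero>\<^bsub>A\<^esub>" using x assms by (simp flip: f.hom_mult)
    then show "f x = f \<zero>" using fg x regular_elementsD(2)[of "f s" A "f x"] by simp
    have "g x \<otimes>\<^bsub>B\<^esub> g s = \<zero>\<^bsub>B\<^esub>" using x assms by (simp flip: g.hom_mult)
    then show "g x = g \<zero>" using fg x regular_elementsD(2)[of "g s" B "g x"] by simp
  qed (use x in auto)
  then show "s \<in> regular_elements R" using assms by (auto simp: regular_elements_def)
qed

lemma divides_iff:
  assumes "x \<in> carrier R" "y \<in> carrier R"
  shows "x divides y \<longleftrightarrow> f x divides\<^bsub>A\<^esub> f y \<and> g x divides\<^bsub>B\<^esub> g y"
proof
  assume "x divides y"
  then show "f x divides\<^bsub>A\<^esub> f y \<and> g x divides\<^bsub>B\<^esub> g y"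
    using assms by (auto simp: factor_def)
next
  assume "f x divides\<^bsub>A\<^esub> f y \<and> g x divides\<^bsub>B\<^esub> g y"
  then obtain a b where "a \<in> carrier A" "b \<in> carrier B" "f y = f x \<otimes>\<^bsub>A\<^esub> a" "g y = g x \<otimes>\<^bsub>B\<^esub> b"
    by (auto simp: factor_def)
  moreover then obtain c where "c \<in> carrier R" "f c = a" "g c = b" by (auto elim: obtain_preimage)
  ultimately have "c \<in> carrier R" "y = x \<otimes> c" using assms by (auto intro!: inj)
  then show "x divides y" by (auto simp: factor_def)
qed

section \<open>Ideals of a product\<close>

lemma ideal_image_fst:
  assumes "ideal J R"
  shows "ideal (f ` J) A"
proof -
  interpret J: ideal J R by fact
  show ?thesis
  proof (rule idealI)
    show "ring A" by (rule A.ring_axioms)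
    show "subgroup (f ` J) (add_monoid A)"
    proof (rule A.add.subgroupI)
      fix a assume "a \<in> f ` J"
      then obtain x where x: "x \<in> J" "a = f x" by auto
      have "\<ominus>\<^bsub>A\<^esub> a = f (\<ominus> x)" using x J.Icarr by simp
      then show "\<ominus>\<^bsub>A\<^esub> a \<in> f ` J" using x(1) by (metis J.a_inv_closed imageI)
    next
      fix a b assume "a \<in> f ` J" "b \<in> f ` J"
      then obtain x y where x: "x \<in> J" "a = f x" "y \<in> J" "b = f y" by auto
      have "a \<oplus>\<^bsub>A\<^esub> b = f (x \<oplus> y)" using x J.Icarr by simp
      then show "a \<oplus>\<^bsub>A\<^esub> b \<in> f ` J" using x by (metis J.a_closed imageI)
    next
      show "f ` J \<subseteq> carrier A" using J.Icarr by auto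
      show "f ` J \<noteq> {}" using J.zero_closed by blast
    qed
    fix a c assume "a \<in> f ` J" "c \<in> carrier A"
    moreover then obtain y where "y \<in> carrier R" "f y = c"
      using obtain_preimage[of c "\<zero>\<^bsub>B\<^esub>"] by auto
    ultimately obtain x where x: "x \<in> J" "a = f x" "y \<in> carrier R" "c = f y" by auto
    have "c \<otimes>\<^bsub>A\<^esub> a = f (y \<otimes> x)" "a \<otimes>\<^bsub>A\<^esub> c = f (x \<otimes> y)"
      using x J.Icarr by simp_all
    then show "c \<otimes>\<^bsub>A\<^esub> a \<in> f ` J" "a \<otimes>\<^bsub>A\<^esub> c \<in> f ` J"
      using x J.I_l_closed J.I_r_closed by (metis imageI)+
  qed
qed

text \<open>The idempotents \<open>e = (1, 0)\<close> and \<open>e' = (0, 1)\<close> glue elements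
  \<open>x\<close> and \<open>y\<close> of \<open>J\<close> with the prescribed components into
  \<open>z = e x + e' y\<close>. Hence an ideal is determined by its two projections.\<close>

lemma mem_ideal_iff:
  assumes "ideal J R" "z \<in> carrier R"
  shows "z \<in> J \<longleftrightarrow> f z \<in> f ` J \<and> g z \<in> g ` J"
proof
  interpret J: ideal J R by fact
  assume "f z \<in> f ` J \<and> g z \<in> g ` J"
  then obtain x y where xy: "x \<in> J" "y \<in> J" "f z = f x" "g z = g y" by auto
  obtain e where e: "e \<in> carrier R" "f e = \<one>\<^bsub>A\<^esub>" "g e = \<zero>\<^bsub>B\<^esub>"
    by (rule obtain_preimage[of "\<one>\<^bsub>A\<^esub>" "\<zero>\<^bsub>B\<^esub>"]) auto
  obtain e' where e': "e' \<in> carrier R" "f e' = \<zero>\<^bsub>A\<^esub>" "g e' = \<one>\<^bsub>B\<^esub>"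
    by (rule obtain_preimage[of "\<zero>\<^bsub>A\<^esub>" "\<one>\<^bsub>B\<^esub>"]) auto
  have "z = e \<otimes> x \<oplus> e' \<otimes> y"
    using xy e e' assms(2) J.Icarr by (intro inj) auto
  then show "z \<in> J" using xy e e' by (auto intro!: J.a_closed J.I_l_closed)
qed auto

lemma regularly_principal:
  assumes "regularly_principal A" "regularly_principal B"
  shows "regularly_principal R"
  unfolding regularly_principal_def
proof (intro allI impI)
  fix J assume J: "ideal J R"
  interpret J: ideal J R by (rule J)
  have "ideal (f ` J) A" "ideal (g ` J) B"
    using J by (rule ideal_image_fst, rule ring_product.ideal_image_fst[OF swap])
  then obtain a b where a: "a \<in> f ` J" and b: "b \<in> g ` J"
    and dvd: "\<And>x. x \<in> f ` J \<Longrightarrow> \<exists>s \<in> regular_elements A. a divides\<^bsub>A\<^esub> s \<otimes>\<^bsub>A\<^esub> x"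
      "\<And>x. x \<in> g ` J \<Longrightarrow> \<exists>s \<in> regular_elements B. b divides\<^bsub>B\<^esub> s \<otimes>\<^bsub>B\<^esub> x"
    using assms unfolding regularly_principal_def by meson
  have "a \<in> carrier A" "b \<in> carrier B" using a b by (auto simp: J.Icarr)
  then obtain c where c: "c \<in> carrier R" "f c = a" "g c = b" by (rule obtain_preimage)
  have "\<exists>s \<in> regular_elements R. c divides s \<otimes> x" if "x \<in> J" for x
  proof -
    have "f x \<in> f ` J" "g x \<in> g ` J" using that by auto
    then obtain s t where s: "s \<in> regular_elements A" "t \<in> regular_elements B"
        "a divides\<^bsub>A\<^esub> s \<otimes>\<^bsub>A\<^esub> f x" "b divides\<^bsub>B\<^esub> t \<otimes>\<^bsub>B\<^esub> g x"
      using dvd by meson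
    then obtain r where "r \<in> carrier R" "f r = s" "g r = t"
      using obtain_preimage regular_elementsD(1) by metis
    then show ?thesis using s c J.Icarr[OF that]
      by (intro bexI[of _ r]) (auto simp: divides_iff regular_iff)
  qed
  moreover have "c \<in> J" using a b c by (simp add: mem_ideal_iff[OF J])
  ultimately show "\<exists>a \<in> J. \<forall>b \<in> J. \<exists>s \<in> regular_elements R. a divides s \<otimes> b" by blast
qed

lemma regularly_pi_regular:
  assumes "regularly_pi_regular A" "regularly_pi_regular B"
  shows "regularly_pi_regular R"
  unfolding regularly_pi_regular_def
proof
  \<comment> \<open>Multiplying by \<open>a^k\<close> raises the exponent; this makes
    \<open>m + n\<close> a common exponent for the two factors.\<close>
  have dvd_add: "a [^]\<^bsub>S\<^esub> Suc (n + k) divides\<^bsub>S\<^esub> s \<otimes>\<^bsub>S\<^esub> a [^]\<^bsub>S\<^esub> (n + k)"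
    if S: "cring S" "a \<in> carrier S" "s \<in> carrier S"
      "a [^]\<^bsub>S\<^esub> Suc n divides\<^bsub>S\<^esub> s \<otimes>\<^bsub>S\<^esub> a [^]\<^bsub>S\<^esub> n"
    for S :: "('x, 'y) ring_scheme" and a s and n k :: nat
  proof -
    interpret S: cring S by (rule S)
    obtain c where c: "c \<in> carrier S" "s \<otimes>\<^bsub>S\<^esub> a [^]\<^bsub>S\<^esub> n = a [^]\<^bsub>S\<^esub> Suc n \<otimes>\<^bsub>S\<^esub> c"
      using S(4) unfolding factor_def by blast
    have "s \<otimes>\<^bsub>S\<^esub> a [^]\<^bsub>S\<^esub> (n + k) = (s \<otimes>\<^bsub>S\<^esub> a [^]\<^bsub>S\<^esub> n) \<otimes>\<^bsub>S\<^esub> a [^]\<^bsub>S\<^esub> k"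
      using that by (simp add: S.nat_pow_mult S.m_assoc)
    also have "\<dots> = a [^]\<^bsub>S\<^esub> Suc n \<otimes>\<^bsub>S\<^esub> c \<otimes>\<^bsub>S\<^esub> a [^]\<^bsub>S\<^esub> k" by (simp only: c)
    also have "\<dots> = (a [^]\<^bsub>S\<^esub> Suc n \<otimes>\<^bsub>S\<^esub> a [^]\<^bsub>S\<^esub> k) \<otimes>\<^bsub>S\<^esub> c"
      using that c by (simp add: S.m_ac)
    also have "a [^]\<^bsub>S\<^esub> Suc n \<otimes>\<^bsub>S\<^esub> a [^]\<^bsub>S\<^esub> k = a [^]\<^bsub>S\<^esub> Suc (n + k)"
      using that by (simp only: S.nat_pow_mult add_Suc)
    finally show ?thesis using c by (auto simp: factor_def)
  qed
  fix x assume x: "x \<in> carrier R"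
  obtain m n :: nat and s t where s: "s \<in> regular_elements A" "t \<in> regular_elements B"
    "f x [^]\<^bsub>A\<^esub> Suc m divides\<^bsub>A\<^esub> s \<otimes>\<^bsub>A\<^esub> f x [^]\<^bsub>A\<^esub> m"
    "g x [^]\<^bsub>B\<^esub> Suc n divides\<^bsub>B\<^esub> t \<otimes>\<^bsub>B\<^esub> g x [^]\<^bsub>B\<^esub> n"
    using assms x f.hom_closed g.hom_closed unfolding regularly_pi_regular_def by meson
  obtain r where r: "r \<in> carrier R" "f r = s" "g r = t"
    using s obtain_preimage regular_elementsD(1) by metis
  have "f x [^]\<^bsub>A\<^esub> Suc (m + n) divides\<^bsub>A\<^esub> s \<otimes>\<^bsub>A\<^esub> f x [^]\<^bsub>A\<^esub> (m + n)"
    "g x [^]\<^bsub>B\<^esub> Suc (m + n) divides\<^bsub>B\<^esub> t \<otimes>\<^bsub>B\<^esub> g x [^]\<^bsub>B\<^esub> (m + n)"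
    using dvd_add[OF A.is_cring _ _ s(3), of n] dvd_add[OF B.is_cring _ _ s(4), of m] s x
    by (auto simp: regular_elementsD add.commute)
  then have "x [^] Suc (m + n) divides r \<otimes> x [^] (m + n)"
    using r x by (simp add: divides_iff f.ring.hom_nat_pow g.ring.hom_nat_pow
        del: nat_pow_Suc A.nat_pow_Suc B.nat_pow_Suc)
  moreover have "r \<in> regular_elements R" using r s by (simp add: regular_iff)
  ultimately show "\<exists>n :: nat. \<exists>s \<in> regular_elements R. x [^] Suc n divides s \<otimes> x [^] n"
    by blast
qed

text \<open>A test set \<open>F\<close> in \<open>A\<close> lifts to the pairs
  \<open>(j, 1)\<close>. In the second component these impose \<open>g s | g b\<close> outright, so
  the lift is again a \<open>GV_set\<close>. Pairing \<open>a\<close> with 0 makes all products with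
  the lift lie in \<open>I\<close>.\<close>

lemma u_closed_ideal_image_fst:
  assumes "u_closed_ideal R I"
  shows "u_closed_ideal A (f ` I)"
  unfolding u_closed_ideal_def
proof (intro conjI allI impI)
  have I: "ideal I R" using assms by (rule u_closed_idealD)
  interpret I: ideal I R by (rule I)
  show "ideal (f ` I) A" using I by (rule ideal_image_fst)
  fix F a
  assume "GV_set A F \<and> a \<in> carrier A \<and> (\<forall>j \<in> F. a \<otimes>\<^bsub>A\<^esub> j \<in> f ` I)"
  then have F: "finite F" "F \<subseteq> carrier A" "F \<inter> regular_elements A \<noteq> {}"
    and dvd: "\<And>b s. \<lbrakk>b \<in> carrier A; s \<in> regular_elements A; \<forall>j \<in> F. s divides\<^bsub>A\<^esub> b \<otimes>\<^bsub>A\<^esub> j\<rbrakk>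
        \<Longrightarrow> s divides\<^bsub>A\<^esub> b"
    and a: "a \<in> carrier A" "\<And>j. j \<in> F \<Longrightarrow> a \<otimes>\<^bsub>A\<^esub> j \<in> f ` I"
    by (auto simp: GV_set_def)
  have "\<forall>j \<in> F. \<exists>x. x \<in> carrier R \<and> f x = j \<and> g x = \<one>\<^bsub>B\<^esub>"
    using F surj by blast
  then obtain h where h: "\<And>j. j \<in> F \<Longrightarrow> h j \<in> carrier R \<and> f (h j) = j \<and> g (h j) = \<one>\<^bsub>B\<^esub>"
    by (metis bchoice)
  have "GV_set R (h ` F)"
    unfolding GV_set_def
  proof (intro conjI ballI impI)
    show "finite (h ` F)" "h ` F \<subseteq> carrier R" using F h by auto
    show "h ` F \<inter> regular_elements R \<noteq> {}"
      using F h by (auto simp: regular_iff B.regular_one)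
    fix b s assume b: "b \<in> carrier R" and s: "s \<in> regular_elements R"
      and d: "\<forall>j \<in> h ` F. s divides b \<otimes> j"
    have sc: "s \<in> carrier R" using s by (rule regular_elementsD)
    have d': "f s divides\<^bsub>A\<^esub> f b \<otimes>\<^bsub>A\<^esub> j \<and> g s divides\<^bsub>B\<^esub> g b" if "j \<in> F" for j
      using d h[OF that] b sc that by (auto simp: divides_iff)
    then have "f s divides\<^bsub>A\<^esub> f b" using b s by (simp add: dvd regular_fst)
    \<comment> \<open>\<open>F\<close> meets the regular elements and so is nonempty; any
      \<open>j\<close> in it gives this.\<close>
    moreover have "g s divides\<^bsub>B\<^esub> g b" using d' F by auto
    ultimately show "s divides b" using b sc by (simp add: divides_iff)
  qed
  moreover obtain x where x: "x \<in> carrier R" "f x = a" "g x = \<zero>\<^bsub>B\<^esub>"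
    using a obtain_preimage[of a "\<zero>\<^bsub>B\<^esub>"] by auto
  moreover have "x \<otimes> h j \<in> I" if "j \<in> F" for j
  proof -
    have "\<zero>\<^bsub>B\<^esub> = g \<zero>" by simp
    then have "\<zero>\<^bsub>B\<^esub> \<in> g ` I" using I.zero_closed by blast
    then show ?thesis using a(2)[OF that] x h[OF that] by (simp add: mem_ideal_iff[OF I])
  qed
  ultimately have "x \<in> I" using u_closed_idealD(2)[OF assms, of "h ` F" x] by auto
  then show "a \<in> f ` I" using x by auto
qed

text \<open>Both projections of the chain become stationary, and by \<open>mem_ideal_iff\<close>
  they determine its members.\<close>

lemma acc_u_closed_ideals:
  assumes "acc_u_closed_ideals A" "acc_u_closed_ideals B"
  shows "acc_u_closed_ideals R"
  unfolding acc_u_closed_ideals_def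
proof (intro allI impI)
  fix I :: "nat \<Rightarrow> _"
  assume I: "(\<forall>n. u_closed_ideal R (I n)) \<and> (\<forall>n. I n \<subseteq> I (Suc n))"
  then have fI: "(\<forall>n. u_closed_ideal A (f ` I n)) \<and> (\<forall>n. f ` I n \<subseteq> f ` I (Suc n))"
    and gI: "(\<forall>n. u_closed_ideal B (g ` I n)) \<and> (\<forall>n. g ` I n \<subseteq> g ` I (Suc n))"
    using u_closed_ideal_image_fst ring_product.u_closed_ideal_image_fst[OF swap]
    by (auto simp: image_mono)
  obtain M where M: "\<And>n. n \<ge> M \<Longrightarrow> f ` I n = f ` I M"
    using assms(1)[unfolded acc_u_closed_ideals_def, THEN spec, THEN mp, OF fI] by blast
  obtain N where N: "\<And>n. n \<ge> N \<Longrightarrow> g ` I n = g ` I N"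
    using assms(2)[unfolded acc_u_closed_ideals_def, THEN spec, THEN mp, OF gI] by blast
  have "I n = I (max M N)" if n: "n \<ge> max M N" for n
  proof -
    have i: "ideal (I n) R" "ideal (I (max M N)) R" using I by (auto dest: u_closed_idealD(1))
    have "f ` I n = f ` I (max M N)"
      using M[of n] M[of "max M N"] n by simp
    moreover have "g ` I n = g ` I (max M N)"
      using N[of n] N[of "max M N"] n by simp
    ultimately have eq: "z \<in> I n \<longleftrightarrow> z \<in> I (max M N)" if "z \<in> carrier R" for z
      by (simp only: mem_ideal_iff[OF i(1) that] mem_ideal_iff[OF i(2) that])
    show ?thesis
    proof (intro equalityI subsetI)
      show "z \<in> I (max M N)" if "z \<in> I n" for z using that eq[of z] ideal.Icarr[OF i(1) that] by simp
      show "z \<in> I n" if "z \<in> I (max M N)" for z using that eq[of z] ideal.Icarr[OF i(2) that] by simp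
    qed
  qed
  then show "\<exists>N. \<forall>n \<ge> N. I n = I N" by blast
qed

end

section \<open>Special primary rings\<close>

lemma (in ring) ideal_chain_Union:
  fixes I :: "nat \<Rightarrow> 'a set"
  assumes "\<And>n. ideal (I n) R" "\<And>n. I n \<subseteq> I (Suc n)"
  shows "ideal (\<Union>n. I n) R"
proof -
  have "I m \<subseteq> I n" if "m \<le> n" for m n
    using that assms(2) by (rule lift_Suc_mono_le[rotated])
  then have "I m \<subseteq> I n \<or> I n \<subseteq> I m" for m n
    using nat_le_linear by blast
  then have "subset.chain {J. ideal J R} (range I)"
    using assms(1) by (auto simp: subset_chain_def)
  from chain_Union_is_ideal[OF this] show ?thesis by simp
qed

text \<open>This says that all ideals are principal, in terms of divisibility and without demanding
  that 1 and 0 differ, since it is also applied to the zero ring.\<close>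

definition ideals_principal :: "('a, 'b) ring_scheme \<Rightarrow> bool" where
  "ideals_principal R \<longleftrightarrow> (\<forall>J. ideal J R \<longrightarrow> (\<exists>a \<in> J. \<forall>b \<in> J. a divides\<^bsub>R\<^esub> b))"

context cring
begin

lemma regularly_principal_of_principal:
  assumes "ideals_principal R"
  shows "regularly_principal R"
  unfolding regularly_principal_def
proof (intro allI impI)
  fix J assume J: "ideal J R"
  then obtain a where "a \<in> J" "\<And>b. b \<in> J \<Longrightarrow> a divides b"
    using assms unfolding ideals_principal_def by meson
  then show "\<exists>a \<in> J. \<forall>b \<in> J. \<exists>s \<in> regular_elements R. a divides s \<otimes> b"
    using regular_one ideal.Icarr[OF J] by (metis l_one)
qed

text \<open>A generator of the union of the chain already lies in some member, which is then the
  whole union.\<close>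

lemma acc_u_closed_ideals_of_principal:
  assumes "ideals_principal R"
  shows "acc_u_closed_ideals R"
  unfolding acc_u_closed_ideals_def
proof (intro allI impI, elim conjE)
  fix I :: "nat \<Rightarrow> _"
  assume u: "\<forall>n. u_closed_ideal R (I n)" and mono: "\<forall>n. I n \<subseteq> I (Suc n)"
  have i: "ideal (I n) R" for n using u u_closed_idealD(1) by blast
  have "ideal (\<Union>n. I n) R" using i mono by (intro ideal_chain_Union) auto
  then obtain a where "a \<in> (\<Union>n. I n)" and dvd: "\<And>b. b \<in> (\<Union>n. I n) \<Longrightarrow> a divides b"
    using assms unfolding ideals_principal_def by meson
  then obtain N where "a \<in> I N" by blast
  have "I n = I N" if "N \<le> n" for n
  proof
    show "I N \<subseteq> I n" by (rule lift_Suc_mono_le[of I]) (use mono that in auto)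
    show "I n \<subseteq> I N"
    proof
      fix b assume "b \<in> I n"
      then have "a divides b" by (intro dvd) auto
      then show "b \<in> I N" using \<open>a \<in> I N\<close> ideal.I_r_closed[OF i] by (auto simp: factor_def)
    qed
  qed
  then show "\<exists>N. \<forall>n \<ge> N. I n = I N" by blast
qed

section \<open>Generators and units of a special primary ring\<close>

lemma power_mem_ideal_power:
  assumes "ideal M R" "a \<in> M"
  shows "a [^] (n :: nat) \<in> M [^]\<^bsub>ideals_set R\<^esub> n"
proof -
  interpret I: comm_monoid "ideals_set R" by (rule ideals_set_is_comm_monoid)
  have a: "a \<in> carrier R" using assms by (rule ideal.Icarr)
  show ?thesis
  proof (induction n)
    case 0
    show ?case by (simp add: I.nat_pow_0) (simp add: ideals_set_def)
  next
    case (Suc n)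
    have "a [^] n \<otimes> a \<in> ideal_prod R (M [^]\<^bsub>ideals_set R\<^esub> n) M"
      using Suc assms(2) by (rule ideal_prod.prod)
    then show ?case by (simp add: I.nat_pow_Suc) (simp add: ideals_set_def)
  qed
qed

lemma divides_one_of_nilpotent:
  assumes "a \<in> carrier R" "x \<in> carrier R" "c \<in> carrier R"
    and "a \<otimes> c = \<one> \<ominus> x" "x [^] (n :: nat) = \<zero>"
  shows "a divides \<one>"
proof -
  \<comment> \<open>Partial sums of the geometric series for \<open>(1 - x)\<^sup>-\<^sup>1\<close>.\<close>
  have "\<exists>d \<in> carrier R. a \<otimes> d = \<one> \<ominus> x [^] k" for k :: nat
  proof (induction k)
    case 0
    show ?case using assms by (intro bexI[of _ \<zero>]) (auto simp: minus_eq r_neg)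
  next
    case (Suc k)
    then obtain d where d: "d \<in> carrier R" "a \<otimes> d = \<one> \<ominus> x [^] k" by blast
    have p: "x [^] k \<in> carrier R" using assms by simp
    have "a \<otimes> (d \<oplus> x [^] k \<otimes> c) = a \<otimes> d \<oplus> x [^] k \<otimes> (a \<otimes> c)"
      using assms(1,2,3) d(1) p by (simp add: r_distr m_ac)
    also have "\<dots> = (\<one> \<ominus> x [^] k) \<oplus> x [^] k \<otimes> (\<one> \<ominus> x)" by (simp only: d assms)
    also have "\<dots> = \<one> \<ominus> x [^] Suc k"
      using assms p by (simp add: minus_eq r_distr r_minus a_assoc r_neg1)
    finally show ?case using assms d p by (intro bexI[of _ "d \<oplus> x [^] k \<otimes> c"]) auto
  qed
  from this[of n] show ?thesis using assms(5) by (force simp: factor_def minus_eq)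
qed

text \<open>For \<open>a\<close> outside the maximal ideal \<open>M = (m)\<close>, maximality gives
  \<open>1 = r m + c a\<close>. Since \<open>r m\<close> is nilpotent, \<open>a c = 1 - r m\<close>
  is a unit, and so is \<open>a\<close>.\<close>

lemma special_primary_ring_generator:
  assumes "special_primary_ring R"
  obtains m and n :: nat where "m \<in> carrier R" "m [^] n = \<zero>"
    "\<And>a. a \<in> carrier R \<Longrightarrow> m divides a \<or> a divides \<one>"
proof -
  obtain M where M: "maximalideal M R"
    using assms unfolding special_primary_ring_def local_ring_def by blast
  then obtain n :: nat where pM: "principalideal M R" and n: "M [^]\<^bsub>ideals_set R\<^esub> n = {\<zero>}"
    using assms unfolding special_primary_ring_def by blast
  interpret M: maximalideal M R by (rule M)
  obtain m where m: "m \<in> carrier R" "M = PIdl m"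
    using principalideal.generate[OF pM] cgenideal_eq_genideal by auto
  have mM: "m \<in> M" using m cgenideal_self by simp
  have m0: "m [^] n = \<zero>" using power_mem_ideal_power[OF M.is_ideal mM, of n] n by simp
  have "a divides \<one>" if a: "a \<in> carrier R" and "\<not> m divides a" for a
  proof -
    have aM: "a \<notin> M"
    proof
      assume "a \<in> M"
      then obtain r where "r \<in> carrier R" "a = r \<otimes> m" unfolding m(2) cgenideal_def by blast
      then have "r \<in> carrier R" "a = m \<otimes> r" using m(1) by (simp_all add: m_comm)
      then show False using that(2) by (auto simp: factor_def)
    qed
    have i: "ideal (M <+> PIdl a) R"
      using M.is_ideal cgenideal_ideal[OF a] by (rule add_ideals)
    have *: "x \<oplus> y \<in> M <+> PIdl a" if "x \<in> M" "y \<in> PIdl a" for x y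
      using that by (auto simp: set_add_def')
    have "M \<subseteq> M <+> PIdl a"
    proof
      fix x assume "x \<in> M"
      then show "x \<in> M <+> PIdl a"
        using *[of x \<zero>] additive_subgroup.zero_closed[OF ideal.axioms(1)[OF cgenideal_ideal[OF a]]]
          M.Icarr by simp
    qed
    moreover have "a \<in> M <+> PIdl a"
      using *[of \<zero> a] cgenideal_self[OF a] a M.zero_closed by simp
    ultimately have "M <+> PIdl a = carrier R"
      using M.I_maximal[OF i] aM ideal.Icarr[OF i] by blast
    then have "\<one> \<in> M <+> PIdl a" by simp
    then obtain r c where r: "r \<in> carrier R" "c \<in> carrier R" "\<one> = r \<otimes> m \<oplus> c \<otimes> a"
      unfolding set_add_def' m cgenideal_def by blast
    have "\<one> \<ominus> r \<otimes> m = c \<otimes> a"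
      unfolding r(3) using r(1,2) m(1) a by (simp add: minus_eq a_ac r_neg)
    then have "a \<otimes> c = \<one> \<ominus> r \<otimes> m" using r a by (simp add: m_comm)
    moreover have "(r \<otimes> m) [^] n = \<zero>" using r m m0 by (simp add: nat_pow_distrib)
    ultimately show ?thesis using r m a by (intro divides_one_of_nilpotent) auto
  qed
  then show thesis using that[OF m(1) m0] by blast
qed

text \<open>Every nonzero element is a unit times a power of \<open>m\<close>, so an ideal is
  generated by the power of \<open>m\<close> with the least exponent among those it
  contains.\<close>

lemma special_primary_ring_principal:
  assumes "special_primary_ring R"
  shows "ideals_principal R"
  unfolding ideals_principal_def
proof (intro allI impI)
  fix J assume J: "ideal J R"
  interpret J: ideal J R by (rule J)
  obtain m and n :: nat where m: "m \<in> carrier R" "m [^] n = \<zero>"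
    and dvd: "\<And>a. a \<in> carrier R \<Longrightarrow> m divides a \<or> a divides \<one>"
    using assms by (rule special_primary_ring_generator) blast
  \<comment> \<open>Such an exponent exists because \<open>m^n = 0\<close> lies in
    \<open>J\<close>.\<close>
  define k where "k = (LEAST k :: nat. m [^] k \<in> J)"
  have k: "m [^] k \<in> J"
    unfolding k_def by (rule LeastI[of "\<lambda>k :: nat. m [^] k \<in> J" n]) (use m J.zero_closed in simp)
  have "m [^] k divides b" if b: "b \<in> J" for b
  proof (cases "b = \<zero>")
    case True
    then show ?thesis using m by (auto simp: factor_def intro!: bexI[of _ \<zero>])
  next
    case False
    have bc: "b \<in> carrier R" using b by (rule J.Icarr)
    \<comment> \<open>A power \<open>m^i\<close> with \<open>i >= n\<close> is zero and cannot
      divide \<open>b\<close>, so there is a largest \<open>i\<close> for which \<open>m^i\<close>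
      divides \<open>b\<close>.\<close>
    have "i < n" if "m [^] i divides b" for i :: nat
    proof (rule ccontr)
      assume "\<not> i < n"
      then have "m [^] n \<otimes> m [^] (i - n) = m [^] i" using m(1) by (simp add: nat_pow_mult)
      then have "m [^] i = \<zero>" using m by simp
      then show False using that False by (auto simp: factor_def)
    qed
    moreover have "m [^] (0 :: nat) divides b" using bc by (auto simp: factor_def)
    ultimately obtain i :: nat where i: "m [^] i divides b"
      and max: "\<And>l :: nat. m [^] l divides b \<Longrightarrow> l \<le> i"
      using ex_has_greatest_nat[of "\<lambda>l :: nat. m [^] l divides b" 0 "\<lambda>l. l" n] by (auto simp: less_imp_le)
    obtain u where u: "u \<in> carrier R" "b = m [^] i \<otimes> u" using i by (auto simp: factor_def)
    \<comment> \<open>Otherwise \<open>m^(i+1)\<close> would divide \<open>b\<close>. Hence the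
      cofactor \<open>u\<close> is a unit.\<close>
    have "\<not> m divides u"
    proof
      assume "m divides u"
      then obtain v where "v \<in> carrier R" "u = m \<otimes> v" by (auto simp: factor_def)
      then have "v \<in> carrier R" "b = m [^] Suc i \<otimes> v" using u m by (simp_all add: m_assoc)
      then have "m [^] Suc i divides b" unfolding factor_def by blast
      then show False using max by fastforce
    qed
    then obtain d where d: "d \<in> carrier R" "\<one> = u \<otimes> d"
      using dvd[OF u(1)] by (auto simp: factor_def)
    have "m [^] i = m [^] i \<otimes> (u \<otimes> d)" using m by (simp flip: d(2))
    also have "\<dots> = b \<otimes> d" using u d m by (simp add: m_assoc)
    finally have "m [^] i \<in> J" using b d by (simp add: J.I_r_closed)
    then have "k \<le> i" unfolding k_def by (rule Least_le)
    then have "m [^] i = m [^] k \<otimes> m [^] (i - k)" using m by (simp add: nat_pow_mult)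
    then have "b = m [^] k \<otimes> (m [^] (i - k) \<otimes> u)" using u m by (simp add: m_assoc)
    then show ?thesis using u m by (auto simp: factor_def)
  qed
  then show "\<exists>a \<in> J. \<forall>b \<in> J. a divides b" using k by blast
qed

text \<open>Here \<open>s = 1\<close> suffices: a multiple of \<open>m\<close> is nilpotent, and any
  other element is a unit.\<close>

lemma special_primary_ring_pi_regular:
  assumes "special_primary_ring R"
  shows "regularly_pi_regular R"
  unfolding regularly_pi_regular_def
proof
  fix a assume a: "a \<in> carrier R"
  obtain m and n :: nat where m: "m \<in> carrier R" "m [^] n = \<zero>"
    and dvd: "m divides a \<or> a divides \<one>"
    using assms a special_primary_ring_generator by metis
  from dvd have "\<exists>n :: nat. a [^] Suc n divides \<one> \<otimes> a [^] n"
  proof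
    assume "m divides a"
    then obtain r where "r \<in> carrier R" "a = m \<otimes> r" by (auto simp: factor_def)
    then have "a [^] n = \<zero>" using m by (simp add: nat_pow_distrib)
    then have "\<one> \<otimes> a [^] n = a [^] Suc n \<otimes> \<zero>" using a by simp
    then show ?thesis unfolding factor_def by blast
  next
    assume "a divides \<one>"
    then have "a [^] Suc 0 divides \<one> \<otimes> a [^] (0 :: nat)" using a by simp
    then show ?thesis by blast
  qed
  then show "\<exists>n :: nat. \<exists>s \<in> regular_elements R. a [^] Suc n divides s \<otimes> a [^] n"
    using regular_one by blast
qed

end

section \<open>Krull domains\<close>

lemma (in domain) regular_iff_nonzero:
  "s \<in> regular_elements R \<longleftrightarrow> s \<in> carrier R \<and> s \<noteq> \<zero>"
proof
  assume s: "s \<in> regular_elements R"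
  then have c: "s \<in> carrier R" by (rule regular_elementsD)
  have "s \<noteq> \<zero>"
    using regular_elementsD(2)[OF s, of \<one>] c by auto
  then show "s \<in> carrier R \<and> s \<noteq> \<zero>" using c by simp
next
  assume "s \<in> carrier R \<and> s \<noteq> \<zero>"
  then show "s \<in> regular_elements R" by (auto simp: regular_elements_def integral_iff)
qed

lemma (in domain) pow_nonzero: "a \<in> carrier R \<Longrightarrow> a \<noteq> \<zero> \<Longrightarrow> a [^] (n :: nat) \<noteq> \<zero>"
  by (induction n) (simp_all add: integral_iff)

text \<open>The valuations of a Krull domain restricted to the nonzero elements of \<open>R\<close>. The members of
  \<open>W\<close> need not be essential; \<open>w \<zero>\<close> is arbitrary.\<close>

locale divisor_valuations = domain R for R (structure) +
  fixes W :: "('a \<Rightarrow> int) set"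
  assumes val_mult: "\<lbrakk>w \<in> W; a \<in> carrier R; b \<in> carrier R; a \<noteq> \<zero>; b \<noteq> \<zero>\<rbrakk> \<Longrightarrow> w (a \<otimes> b) = w a + w b"
    and divides_iff_val:
      "\<lbrakk>a \<in> carrier R; b \<in> carrier R; a \<noteq> \<zero>; b \<noteq> \<zero>\<rbrakk> \<Longrightarrow> a divides b \<longleftrightarrow> (\<forall>w \<in> W. w a \<le> w b)"
    and finite_val: "\<lbrakk>a \<in> carrier R; a \<noteq> \<zero>\<rbrakk> \<Longrightarrow> finite {w \<in> W. w a \<noteq> 0}"
begin

section \<open>Values, minima and divisibility\<close>

lemma val_one: "w \<in> W \<Longrightarrow> w \<one> = 0"
  using val_mult[of w \<one> \<one>] by simp

lemma val_le_of_divides: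
  assumes "a divides b" "w \<in> W" "a \<in> carrier R" "b \<in> carrier R" "a \<noteq> \<zero>" "b \<noteq> \<zero>"
  shows "w a \<le> w b"
  using assms divides_iff_val by blast

lemma divides_of_val_le:
  assumes "\<And>w. w \<in> W \<Longrightarrow> w a \<le> w b" "a \<in> carrier R" "b \<in> carrier R" "a \<noteq> \<zero>" "b \<noteq> \<zero>"
  shows "a divides b"
  using assms divides_iff_val by blast

lemma val_nonneg:
  assumes "w \<in> W" "a \<in> carrier R" "a \<noteq> \<zero>"
  shows "0 \<le> w a"
proof -
  have "\<one> divides a" using assms by (auto simp: factor_def)
  then have "w \<one> \<le> w a" using assms by (rule_tac val_le_of_divides) auto
  then show ?thesis using assms by (simp add: val_one)
qed

lemma val_pow:
  assumes "w \<in> W" "a \<in> carrier R" "a \<noteq> \<zero>"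
  shows "w (a [^] (n :: nat)) = int n * w a"
proof (induction n)
  case 0
  show ?case using assms by (simp add: val_one)
next
  case (Suc n)
  have "a [^] n \<noteq> \<zero>" using assms pow_nonzero by blast
  then show ?case using Suc assms by (simp add: val_mult algebra_simps)
qed

text \<open>Fix \<open>a\<close> in \<open>S\<close>. For all but finitely many \<open>w\<close> the
  value \<open>w a\<close> is 0, the smallest possible value; each remaining \<open>w\<close>
  contributes one element at which its minimum is attained.\<close>

lemma finite_minimizers:
  assumes "S \<subseteq> carrier R - {\<zero>}" "S \<noteq> {}"
  obtains F where "finite F" "F \<subseteq> S" "F \<noteq> {}"
    "\<And>w x. w \<in> W \<Longrightarrow> x \<in> S \<Longrightarrow> \<exists>y \<in> F. w y \<le> w x"
proof -
  obtain a where a: "a \<in> S" using assms by blast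
  define D where "D = {w \<in> W. w a \<noteq> 0}"
  have D: "finite D" unfolding D_def using a assms by (intro finite_val) auto
  have "\<exists>y \<in> S. \<forall>x \<in> S. w y \<le> w x" if "w \<in> W" for w
  proof -
    \<comment> \<open>Values on \<open>S\<close> are nonnegative, so \<open>nat\<close> preserves
      their order and well-foundedness supplies a least one.\<close>
    obtain y where y: "y \<in> S" "\<forall>x. x \<in> S \<longrightarrow> nat (w y) \<le> nat (w x)"
      using ex_has_least_nat[of "\<lambda>x. x \<in> S" a "\<lambda>x. nat (w x)"] a by auto
    have "w y \<le> w x" if "x \<in> S" for x
    proof -
      have "0 \<le> w x" using that assms val_nonneg[OF \<open>w \<in> W\<close>, of x] by auto
      moreover have "nat (w y) \<le> nat (w x)" using y that by blast
      ultimately show ?thesis by linarith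
    qed
    then show ?thesis using y by blast
  qed
  then obtain h where h: "\<And>w. w \<in> W \<Longrightarrow> h w \<in> S \<and> (\<forall>x \<in> S. w (h w) \<le> w x)"
    by metis
  show thesis
  proof (rule that[of "insert a (h ` D)"])
    show "insert a (h ` D) \<subseteq> S" using a h by (auto simp: D_def)
    fix w x assume w: "w \<in> W" and x: "x \<in> S"
    show "\<exists>y \<in> insert a (h ` D). w y \<le> w x"
    proof (cases "w \<in> D")
      case True
      then show ?thesis using h[OF w] x by blast
    next
      case False
      then have "w a = 0" using w by (simp add: D_def)
      then show ?thesis using val_nonneg[OF w, of x] x assms by auto
    qed
  qed (use D in auto)
qed

text \<open>This is complete integral closedness for \<open>y = b/s\<close>: if all
  \<open>y^n a\<close> lie in \<open>R\<close>, then \<open>n (w s - w b) <= w a\<close> for every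
  \<open>n\<close>, which forces \<open>w s <= w b\<close>.\<close>

lemma divides_of_powers:
  assumes "a \<in> carrier R" "a \<noteq> \<zero>" "b \<in> carrier R" "b \<noteq> \<zero>" "s \<in> carrier R" "s \<noteq> \<zero>"
    and "\<And>n :: nat. s [^] n divides b [^] n \<otimes> a"
  shows "s divides b"
proof -
  have "w s \<le> w b" if w: "w \<in> W" for w
  proof (rule ccontr)
    assume "\<not> w s \<le> w b"
    \<comment> \<open>An exponent just above \<open>w a\<close> is enough, because
      \<open>w s - w b >= 1\<close>.\<close>
    define n where "n = nat (w a + 1)"
    have pn: "s [^] n \<noteq> \<zero>" "b [^] n \<noteq> \<zero>" using assms pow_nonzero by blast+
    then have "w (s [^] n) \<le> w (b [^] n \<otimes> a)"
      using assms(1-6) w by (intro val_le_of_divides[OF assms(7)]) (simp_all add: integral_iff)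
    then have "int n * w s \<le> int n * w b + w a"
      using assms w pn by (simp add: val_mult val_pow)
    moreover have "int n = w a + 1" using val_nonneg[OF w, of a] assms by (simp add: n_def)
    moreover have "int n * (w b + 1) \<le> int n * w s"
      using \<open>\<not> w s \<le> w b\<close> by (intro mult_left_mono) auto
    ultimately show False by (simp add: algebra_simps)
  qed
  then show ?thesis using assms by (simp add: divides_iff_val)
qed

text \<open>The hypothesis \<open>nz\<close> is separate from \<open>le\<close> because
  \<open>W\<close> may be empty, as for a field, and \<open>le\<close> is then void.\<close>

lemma mem_u_closed_ideal:
  assumes I: "u_closed_ideal R I" and x: "x \<in> carrier R" "x \<noteq> \<zero>"
    and nz: "\<exists>a \<in> I. a \<noteq> \<zero>"
    and le: "\<And>w. w \<in> W \<Longrightarrow> \<exists>a \<in> I. a \<noteq> \<zero> \<and> w a \<le> w x"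
  shows "x \<in> I"
proof -
  interpret I: ideal I R using I by (rule u_closed_idealD)
  \<comment> \<open>\<open>B\<close> is \<open>(I : x)\<close> without 0, at which the valuations
    carry no meaning.\<close>
  define B where "B = {r \<in> carrier R - {\<zero>}. r \<otimes> x \<in> I}"
  obtain a where a: "a \<in> I" "a \<noteq> \<zero>" "a \<in> carrier R" using nz I.Icarr by blast
  have "a \<in> B" using a x by (auto simp: B_def I.I_r_closed)
  then obtain F where F: "finite F" "F \<subseteq> B" "F \<noteq> {}"
    and min: "\<And>w r. w \<in> W \<Longrightarrow> r \<in> B \<Longrightarrow> \<exists>y \<in> F. w y \<le> w r"
    using finite_minimizers[of B] by (auto simp: B_def)
  have Fc: "j \<in> carrier R" "j \<noteq> \<zero>" "j \<otimes> x \<in> I" if "j \<in> F" for j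
    using that F by (auto simp: B_def)
  have "s divides b" if b: "b \<in> carrier R" and s: "s \<in> carrier R" "s \<noteq> \<zero>"
    and d: "\<And>j. j \<in> F \<Longrightarrow> s divides b \<otimes> j" for b s
  proof (cases "b = \<zero>")
    case True
    then show ?thesis using s by (auto simp: factor_def intro!: bexI[of _ \<zero>])
  next
    case False
    \<comment> \<open>On \<open>F\<close> every valuation attains its minimum over \<open>B\<close>,
      so \<open>b/s\<close> multiplies all of \<open>B\<close> into \<open>R\<close> as soon as it
      does so with \<open>F\<close>.\<close>
    have sB: "s divides b \<otimes> r" if r: "r \<in> B" for r
    proof -
      have rc: "r \<in> carrier R" "r \<noteq> \<zero>" using r by (auto simp: B_def)
      have "w s \<le> w (b \<otimes> r)" if w: "w \<in> W" for w
      proof -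
        obtain y where y: "y \<in> F" "w y \<le> w r" using min[OF w r] by blast
        have "w s \<le> w (b \<otimes> y)"
          using Fc[OF y(1)] s b False w
          by (intro val_le_of_divides[OF d[OF y(1)]]) (simp_all add: integral_iff)
        then show ?thesis using y Fc[OF y(1)] rc b False w by (simp add: val_mult)
      qed
      then show ?thesis using rc s b False
        by (rule_tac divides_of_val_le) (simp_all add: integral_iff)
    qed
    have pow: "s [^] n \<noteq> \<zero>" "b [^] n \<noteq> \<zero>" for n :: nat
      using s b False pow_nonzero by blast+
    \<comment> \<open>For \<open>y = b/s\<close> this says \<open>y\<^sup>n \<in> I\<^sup>-\<^sup>1\<close>; in the induction step \<open>c = y\<^sup>n i\<close> and \<open>t = y\<^sup>n x\<close>.\<close>
    have "s [^] n divides b [^] n \<otimes> i" if "i \<in> I" "i \<noteq> \<zero>" for n :: nat and i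
      using that
    proof (induction n arbitrary: i)
      case 0
      then show ?case using I.Icarr by (auto simp: factor_def)
    next
      case (Suc n)
      have i: "i \<in> carrier R" using Suc.prems I.Icarr by blast
      obtain c where c: "c \<in> carrier R" "b [^] n \<otimes> i = s [^] n \<otimes> c"
        using Suc.IH[OF Suc.prems] by (auto simp: factor_def)
      have cnz: "c \<noteq> \<zero>"
      proof
        assume "c = \<zero>"
        then have "b [^] n \<otimes> i = \<zero>" using c s by simp
        then show False using Suc.prems i b pow by (simp add: integral_iff)
      qed
      \<comment> \<open>Each \<open>w\<close> may need its own \<open>i'\<close>; this is why the
        induction treats all \<open>i\<close> in \<open>I\<close> at once.\<close>
      have "w (s [^] n) \<le> w (b [^] n \<otimes> x)" if w: "w \<in> W" for w
      proof -
        obtain i' where i': "i' \<in> I" "i' \<noteq> \<zero>" "w i' \<le> w x" using le[OF w] by blast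
        then have ic: "i' \<in> carrier R" using I.Icarr by blast
        have "w (s [^] n) \<le> w (b [^] n \<otimes> i')"
          using i'(2) ic s b pow w
          by (intro val_le_of_divides[OF Suc.IH[OF i'(1,2)]]) (simp_all add: integral_iff)
        then show ?thesis using i' ic x b pow w by (simp add: val_mult)
      qed
      then have "s [^] n divides b [^] n \<otimes> x"
        using x s b pow by (rule_tac divides_of_val_le) (simp_all add: integral_iff)
      then obtain t where t: "t \<in> carrier R" "b [^] n \<otimes> x = s [^] n \<otimes> t"
        by (auto simp: factor_def)
      have "s [^] n \<otimes> (c \<otimes> x) = (s [^] n \<otimes> c) \<otimes> x" using s c x by (simp add: m_assoc)
      also have "\<dots> = (b [^] n \<otimes> i) \<otimes> x" by (simp only: c)
      also have "\<dots> = (b [^] n \<otimes> x) \<otimes> i" using b i x by (simp add: m_ac)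
      also have "\<dots> = (s [^] n \<otimes> t) \<otimes> i" by (simp only: t)
      also have "\<dots> = s [^] n \<otimes> (t \<otimes> i)" using s t i by (simp add: m_assoc)
      \<comment> \<open>Since \<open>t i\<close> lies in \<open>I\<close>, this puts
        \<open>c\<close> into \<open>B\<close>, and \<open>sB\<close> absorbs one more factor
        \<open>b/s\<close>.\<close>
      finally have "c \<otimes> x = t \<otimes> i"
        using m_lcancel[OF pow(1), of n "c \<otimes> x" "t \<otimes> i"] s c x t i by simp
      then have "c \<in> B" using c cnz t Suc.prems by (simp add: B_def I.I_l_closed)
      then obtain e where e: "e \<in> carrier R" "b \<otimes> c = s \<otimes> e" using sB by (auto simp: factor_def)
      have "b [^] Suc n \<otimes> i = b \<otimes> (b [^] n \<otimes> i)" using b i by (simp add: m_ac)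
      also have "\<dots> = b \<otimes> (s [^] n \<otimes> c)" by (simp only: c)
      also have "\<dots> = s [^] n \<otimes> (b \<otimes> c)" using b s c by (simp add: m_ac)
      also have "\<dots> = s [^] n \<otimes> (s \<otimes> e)" by (simp only: e)
      also have "\<dots> = s [^] Suc n \<otimes> e" using s e by (simp add: m_assoc)
      finally show ?case using e unfolding factor_def by blast
    qed
    \<comment> \<open>A single nonzero \<open>a\<close> in \<open>I\<close> is a common denominator
      for all powers of \<open>b/s\<close>.\<close>
    then show ?thesis using a b s False divides_of_powers[of a b s] by blast
  qed
  then have "GV_set R F"
    unfolding GV_set_def using F Fc by (auto simp: regular_iff_nonzero)
  then show "x \<in> I" using u_closed_idealD(2)[OF I] x Fc m_comm by metis
qed

lemma acc_u_closed_ideals: "acc_u_closed_ideals R"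
  unfolding acc_u_closed_ideals_def
proof (intro allI impI, elim conjE)
  fix I :: "nat \<Rightarrow> _"
  assume u: "\<forall>n. u_closed_ideal R (I n)" and suc: "\<forall>n. I n \<subseteq> I (Suc n)"
  have i: "ideal (I n) R" for n using u u_closed_idealD(1) by blast
  have mono: "I m \<subseteq> I n" if "m \<le> n" for m n
    by (rule lift_Suc_mono_le[of I]) (use suc that in auto)
  \<comment> \<open>The valuations say nothing about 0, so it is removed; the chain of zero ideals
    is treated apart.\<close>
  define S where "S = (\<Union>n. I n) - {\<zero>}"
  show "\<exists>N. \<forall>n \<ge> N. I n = I N"
  proof (cases "S = {}")
    case True
    have "I n = {\<zero>}" for n
      using True additive_subgroup.zero_closed[OF ideal.axioms(1)[OF i]] by (auto simp: S_def)
    then show ?thesis by blast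
  next
    case False
    moreover have "S \<subseteq> carrier R - {\<zero>}" using ideal.Icarr[OF i] by (auto simp: S_def)
    ultimately obtain F where F: "finite F" "F \<subseteq> S" "F \<noteq> {}"
      and min: "\<And>w x. w \<in> W \<Longrightarrow> x \<in> S \<Longrightarrow> \<exists>y \<in> F. w y \<le> w x"
      using finite_minimizers by metis
    have "\<forall>y \<in> F. \<exists>n. y \<in> I n" using F by (auto simp: S_def)
    then obtain h where h: "\<And>y. y \<in> F \<Longrightarrow> y \<in> I (h y)" by metis
    define N where "N = Max (h ` F)"
    have FN: "F \<subseteq> I N"
    proof
      fix y assume "y \<in> F"
      then have "h y \<le> N" unfolding N_def using F by simp
      then show "y \<in> I N" using mono h \<open>y \<in> F\<close> by blast
    qed
    have "I n = I N" if "N \<le> n" for n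
    proof
      show "I N \<subseteq> I n" using that by (rule mono)
      show "I n \<subseteq> I N"
      proof
        fix x assume x: "x \<in> I n"
        show "x \<in> I N"
        proof (cases "x = \<zero>")
          case True
          then show ?thesis
            using additive_subgroup.zero_closed[OF ideal.axioms(1)[OF i]] by simp
        next
          case False
          then have xS: "x \<in> S" using x by (auto simp: S_def)
          show ?thesis
          proof (rule mem_u_closed_ideal)
            show "u_closed_ideal R (I N)" using u by blast
            show "x \<in> carrier R" using ideal.Icarr[OF i x] .
            show "\<exists>a \<in> I N. a \<noteq> \<zero>" using F FN by (auto simp: S_def)
            show "\<exists>a \<in> I N. a \<noteq> \<zero> \<and> w a \<le> w x" if "w \<in> W" for w
              using min[OF that xS] F FN by (auto simp: S_def)
          qed (rule False)
        qed
      qed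
    qed
    then show ?thesis by blast
  qed
qed

end

text \<open>The valuations of the quotient field are restricted along \<open>to_tq\<close>. The
  element \<open>a/s\<close> lies in \<open>R\<close> iff \<open>v (a/s) >= 0\<close> for all
  \<open>v\<close>, and multiplicativity turns this into \<open>v s <= v a\<close>.\<close>

lemma krull_domain_valuations:
  fixes R (structure)
  assumes "krull_domain R"
  obtains W where "divisor_valuations R W"
proof -
  interpret domain R using assms by (simp add: krull_domain_def)
  interpret T: cring TQ by (rule cring_TQ)
  have "\<exists>V. (\<forall>v \<in> V. discrete_valuation TQ v) \<and>
      to_tq R ` carrier R = {x \<in> carrier TQ. x = \<zero>\<^bsub>TQ\<^esub> \<or> (\<forall>v \<in> V. 0 \<le> v x)} \<and>
      (\<forall>x \<in> carrier TQ - {\<zero>\<^bsub>TQ\<^esub>}. finite {v \<in> V. v x \<noteq> 0})"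
    using assms unfolding krull_domain_def Let_def by (rule conjunct2)
  then obtain V where V: "\<forall>v \<in> V. discrete_valuation TQ v"
    and R: "to_tq R ` carrier R = {x \<in> carrier TQ. x = \<zero>\<^bsub>TQ\<^esub> \<or> (\<forall>v \<in> V. 0 \<le> v x)}"
    and fin: "\<forall>x \<in> carrier TQ - {\<zero>\<^bsub>TQ\<^esub>}. finite {v \<in> V. v x \<noteq> 0}"
    by (elim exE conjE)
  have v_mult: "v (x \<otimes>\<^bsub>TQ\<^esub> y) = v x + v y"
    if "v \<in> V" "x \<in> carrier TQ - {\<zero>\<^bsub>TQ\<^esub>}" "y \<in> carrier TQ - {\<zero>\<^bsub>TQ\<^esub>}" for v x y
    using bspec[OF V that(1)] that(2,3) unfolding discrete_valuation_def by blast
  have nz: "to_tq R a \<in> carrier TQ - {\<zero>\<^bsub>TQ\<^esub>}" if "a \<in> carrier R" "a \<noteq> \<zero>" for a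
    using that to_tq_eq_iff[of a \<zero>] to_tq_closed[of a] by (simp add: TQ_zero to_tq_def)
  have "divisor_valuations R ((\<lambda>v. v \<circ> to_tq R) ` V)"
  proof unfold_locales
    fix w a b
    assume "w \<in> (\<lambda>v. v \<circ> to_tq R) ` V" and ab: "a \<in> carrier R" "b \<in> carrier R" "a \<noteq> \<zero>" "b \<noteq> \<zero>"
    then obtain v where v: "v \<in> V" "w = v \<circ> to_tq R" by blast
    show "w (a \<otimes> b) = w a + w b"
      using v_mult[OF v(1) nz[OF ab(1,3)] nz[OF ab(2,4)]] ab
      by (simp add: v(2) ring_hom_mult[OF to_tq_hom])
  next
    fix s a assume s: "s \<in> carrier R" "a \<in> carrier R" "s \<noteq> \<zero>" "a \<noteq> \<zero>"
    have sr: "s \<in> regular_elements R" using s by (simp add: regular_iff_nonzero)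
    have q: "fraction R a s \<in> carrier TQ - {\<zero>\<^bsub>TQ\<^esub>}"
      using s sr by (simp add: fraction_closed TQ_zero fraction_eq_iff regular_one)
    have val: "0 \<le> v (fraction R a s) \<longleftrightarrow> v (to_tq R s) \<le> v (to_tq R a)" if "v \<in> V" for v
      using v_mult[OF that q nz[OF s(1,3)]] fraction_mult_denominator[OF s(2) sr] by simp
    have "s divides a \<longleftrightarrow> (\<forall>v \<in> V. 0 \<le> v (fraction R a s))"
      using fraction_in_image_iff[OF s(2) sr] q unfolding R by simp
    also have "\<dots> \<longleftrightarrow> (\<forall>v \<in> V. v (to_tq R s) \<le> v (to_tq R a))"
      using val by (intro ball_cong refl)
    finally show "s divides a \<longleftrightarrow> (\<forall>w \<in> (\<lambda>v. v \<circ> to_tq R) ` V. w s \<le> w a)" by simp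
  next
    fix a assume a: "a \<in> carrier R" "a \<noteq> \<zero>"
    have "{w \<in> (\<lambda>v. v \<circ> to_tq R) ` V. w a \<noteq> 0} = (\<lambda>v. v \<circ> to_tq R) ` {v \<in> V. v (to_tq R a) \<noteq> 0}"
      by auto
    then show "finite {w \<in> (\<lambda>v. v \<circ> to_tq R) ` V. w a \<noteq> 0}"
      using bspec[OF fin nz[OF a]] by simp
  qed
  then show thesis by (rule that)
qed

text \<open>A nonzero \<open>a\<close> in \<open>J\<close> is regular and divides
  \<open>a b\<close>, so the choice \<open>s = a\<close> works for every \<open>b\<close>.\<close>

lemma (in domain) domain_regularly_principal: "regularly_principal R"
  unfolding regularly_principal_def
proof (intro allI impI)
  fix J assume J: "ideal J R"
  interpret J: ideal J R by (rule J)
  show "\<exists>a \<in> J. \<forall>b \<in> J. \<exists>s \<in> regular_elements R. a divides s \<otimes> b"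
  proof (cases "J = {\<zero>}")
    case True
    then show ?thesis using regular_one by (auto simp: factor_def intro!: bexI[of _ \<one>])
  next
    case False
    then obtain a where a: "a \<in> J" "a \<noteq> \<zero>" using J.zero_closed by blast
    have "\<exists>s \<in> regular_elements R. a divides s \<otimes> b" if "b \<in> J" for b
      using a J.Icarr that by (intro bexI[of _ a]) (auto simp: regular_iff_nonzero factor_def)
    then show ?thesis using a by blast
  qed
qed

lemma (in domain) domain_pi_regular: "regularly_pi_regular R"
  unfolding regularly_pi_regular_def
proof
  fix a assume a: "a \<in> carrier R"
  show "\<exists>n :: nat. \<exists>s \<in> regular_elements R. a [^] Suc n divides s \<otimes> a [^] n"
  proof (cases "a = \<zero>")
    case True
    \<comment> \<open>The exponent is 1 because \<open>0^1\<close> does not divide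
      \<open>s 0^0 = s\<close> for a regular \<open>s\<close>.\<close>
    then have "a [^] Suc 1 divides \<one> \<otimes> a [^] (1 :: nat)"
      by (auto simp: factor_def intro!: bexI[of _ \<one>])
    then show ?thesis using regular_one by blast
  next
    case False
    then have "a [^] Suc 0 divides a \<otimes> a [^] (0 :: nat)" "a \<in> regular_elements R"
      using a by (auto simp: factor_def regular_iff_nonzero intro!: bexI[of _ \<one>])
    then show ?thesis by blast
  qed
qed

section \<open>General Krull rings\<close>

definition krull_like :: "('a, 'b) ring_scheme \<Rightarrow> bool" where
  "krull_like R \<longleftrightarrow> cring R \<and> regularly_principal R \<and> regularly_pi_regular R \<and> acc_u_closed_ideals R"

lemma krull_domain_krull_like:
  assumes "krull_domain R"
  shows "krull_like R"
proof -
  interpret domain R using assms by (simp add: krull_domain_def)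
  obtain W where "divisor_valuations R W" using assms by (rule krull_domain_valuations)
  then have "acc_u_closed_ideals R" by (rule divisor_valuations.acc_u_closed_ideals)
  then show ?thesis
    by (simp add: krull_like_def is_cring domain_regularly_principal domain_pi_regular)
qed

lemma special_primary_ring_krull_like:
  assumes "special_primary_ring R"
  shows "krull_like R"
proof -
  interpret cring R using assms by (simp add: special_primary_ring_def local_ring_def)
  show ?thesis
    using special_primary_ring_principal[OF assms] special_primary_ring_pi_regular[OF assms]
    by (simp add: krull_like_def is_cring regularly_principal_of_principal
        acc_u_closed_ideals_of_principal)
qed

lemma special_primary_ring_nontrivial:
  fixes R (structure)
  assumes "special_primary_ring R"
  shows "\<one> \<noteq> \<zero>"
proof
  interpret cring R using assms by (simp add: special_primary_ring_def local_ring_def)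
  obtain M where "maximalideal M R"
    using assms unfolding special_primary_ring_def local_ring_def by blast
  then interpret M: maximalideal M R .
  assume "\<one> = \<zero>"
  then have "\<one> \<in> M" using M.zero_closed by simp
  then show False using M.one_imp_carrier M.I_notcarr by auto
qed

text \<open>Only \<open>ring R\<close> is assumed: commutativity is pulled back from
  \<open>A\<close> and \<open>B\<close> along the injective \<open>h\<close>. This is how products
  of lists are seen to be commutative.\<close>

lemma ring_product_of_iso:
  fixes R :: "('a, 'b) ring_scheme"
  assumes h: "h \<in> ring_iso R (RDirProd A B)" and "ring R" "cring A" "cring B"
  shows "ring_product R A B (fst \<circ> h) (snd \<circ> h)"
proof -
  interpret R: ring R by fact
  interpret A: cring A by fact
  interpret B: cring B by fact
  have hom: "h \<in> ring_hom R (RDirProd A B)" and bij: "bij_betw h (carrier R) (carrier A \<times> carrier B)"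
    using h by (auto simp: ring_iso_def RDirProd_carrier)
  have "fst \<in> ring_hom (RDirProd A B) A" "snd \<in> ring_hom (RDirProd A B) B"
    by (auto simp: ring_hom_def RDirProd_def DirProd_def monoid.defs)
  then have f: "fst \<circ> h \<in> ring_hom R A" and g: "snd \<circ> h \<in> ring_hom R B"
    using ring_hom_trans[OF hom] by auto
  have inj: "x = y" if "x \<in> carrier R" "y \<in> carrier R" "fst (h x) = fst (h y)" "snd (h x) = snd (h y)"
    for x y
    using bij that unfolding bij_betw_def inj_on_def by (metis prod_eqI)
  have surj: "\<exists>x \<in> carrier R. h x = (a, b)" if "a \<in> carrier A" "b \<in> carrier B" for a b
  proof -
    have "(a, b) \<in> h ` carrier R" using bij that by (simp add: bij_betw_def)
    then show ?thesis by force
  qed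
  have "comm_monoid R"
  proof (rule R.monoid_comm_monoidI)
    fix x y assume "x \<in> carrier R" "y \<in> carrier R"
    then show "x \<otimes>\<^bsub>R\<^esub> y = y \<otimes>\<^bsub>R\<^esub> x"
      using f g ring_hom_mult[OF f] ring_hom_mult[OF g]
        A.m_comm[of "fst (h x)" "fst (h y)"] B.m_comm[of "snd (h x)" "snd (h y)"]
        ring_hom_closed[OF f] ring_hom_closed[OF g]
      by (intro inj) auto
  qed
  then have R: "cring R" by (intro cring.intro R.ring_axioms)
  show ?thesis
  proof (intro ring_product.intro ring_hom_cring.intro ring_hom_cring_axioms.intro
      ring_product_axioms.intro R assms f g)
    show "\<exists>x \<in> carrier R. (fst \<circ> h) x = a \<and> (snd \<circ> h) x = b"
      if "a \<in> carrier A" "b \<in> carrier B" for a b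
      using surj[OF that] by force
  qed (use inj in auto)
qed

lemma (in ring_product) krull_like:
  assumes "krull_like A" "krull_like B"
  shows "krull_like R"
  using assms regularly_principal regularly_pi_regular acc_u_closed_ideals
  by (simp add: krull_like_def is_cring)

lemma trivial_krull_like:
  fixes R (structure)
  assumes "cring R" "carrier R = {\<zero>}"
  shows "krull_like R"
proof -
  interpret cring R by fact
  have "ideals_principal R"
    unfolding ideals_principal_def
  proof (intro allI impI)
    fix J assume J: "ideal J R"
    have "J = {\<zero>}"
      using additive_subgroup.zero_closed[OF ideal.axioms(1)[OF J]] ideal.Icarr[OF J] assms(2) by blast
    then show "\<exists>a \<in> J. \<forall>b \<in> J. a divides b" by (auto simp: factor_def)
  qed
  moreover have "regularly_pi_regular R"
    unfolding regularly_pi_regular_def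
  proof
    fix a assume "a \<in> carrier R"
    then have "a [^] Suc 1 divides \<one> \<otimes> a [^] (1 :: nat)"
      unfolding assms(2) by (auto simp: factor_def)
    then show "\<exists>n :: nat. \<exists>s \<in> regular_elements R. a [^] Suc n divides s \<otimes> a [^] n"
      using regular_one by blast
  qed
  ultimately show ?thesis
    by (simp add: krull_like_def is_cring regularly_principal_of_principal
        acc_u_closed_ideals_of_principal)
qed

text \<open>The isomorphism \<open>k\<close> splits the head component off from the rest, so that
  the lemmas on two factors apply to products of lists.\<close>

lemma RDirProd_list_Cons_product:
  fixes R :: "('a, 'b) ring_scheme" and A :: "('c, 'd) ring_scheme"
  assumes "h \<in> ring_iso R (RDirProd_list (A # Rs))" "ring R" "cring A" "cring (RDirProd_list Rs)"
  obtains f g where "ring_product R A (RDirProd_list Rs) f g"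
proof -
  obtain k where "k \<in> ring_iso (RDirProd_list (A # Rs)) (RDirProd A (RDirProd_list Rs))"
    using RDirProd_list_iso2 by blast
  with assms(1) have "k \<circ> h \<in> ring_iso R (RDirProd A (RDirProd_list Rs))"
    by (rule ring_iso_set_trans)
  from ring_product_of_iso[OF this assms(2-4)] show thesis by (rule that)
qed

lemma RDirProd_list_krull_like:
  assumes "\<And>S. S \<in> set Rs \<Longrightarrow> krull_like S"
  shows "krull_like (RDirProd_list Rs)"
  using assms
proof (induction Rs)
  case Nil
  have "ring (RDirProd_list ([] :: ('a, 'b) ring_scheme list))"
    by (rule RDirProd_list_is_ring) simp
  then interpret ring "RDirProd_list ([] :: ('a, 'b) ring_scheme list)" .
  have "cring (RDirProd_list ([] :: ('a, 'b) ring_scheme list))"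
    by (intro cring.intro ring_axioms monoid_comm_monoidI) simp
  then show ?case by (rule trivial_krull_like) (simp add: monoid.defs)
next
  case (Cons A Rs)
  then have K: "krull_like A" "krull_like (RDirProd_list Rs)" by auto
  have "ring (RDirProd_list (A # Rs))"
    using Cons.prems by (intro RDirProd_list_is_ring)
      (metis nth_mem krull_like_def cring.axioms(1))
  then obtain f g where "ring_product (RDirProd_list (A # Rs)) A (RDirProd_list Rs) f g"
    using RDirProd_list_Cons_product[OF ring_iso_set_refl] K unfolding krull_like_def by blast
  then show ?case using K by (rule ring_product.krull_like)
qed

theorem corollary6p9:
  fixes R :: "('a, 'b) ring_scheme"
  assumes "general_krull_ring R"
  shows "(krull_dim (total_quotient_ring R) = 0 \<and> principal_ideal_ring (total_quotient_ring R)) \<and>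
         (acc_integral_u_ideals R \<and> u_noetherian R)"
proof -
  interpret cring R using assms by (simp add: general_krull_ring_def)
  obtain Rs :: "'a ring list" where ne: "Rs \<noteq> []"
    and Rs: "\<And>S. S \<in> set Rs \<Longrightarrow> krull_domain S \<or> special_primary_ring S"
    and iso: "R \<simeq> RDirProd_list Rs"
    using assms unfolding general_krull_ring_def by blast
  \<comment> \<open>A first factor \<open>A\<close> is split off because \<open>krull_like\<close>
    does not exclude the zero ring: that 1 and 0 differ in \<open>R\<close> is read off from
    \<open>A\<close> through the homomorphism \<open>f\<close>.\<close>
  obtain A Rs' where A: "Rs = A # Rs'" using ne by (cases Rs) auto
  have good: "krull_like S" if "S \<in> set Rs" for S
    using Rs[OF that] krull_domain_krull_like special_primary_ring_krull_like by blast
  have KA: "krull_like A" and KB: "krull_like (RDirProd_list Rs')"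
    using good by (auto simp: A intro: RDirProd_list_krull_like)
  have cAB: "cring A" "cring (RDirProd_list Rs')"
    using KA KB by (simp_all add: krull_like_def)
  obtain h where "h \<in> ring_iso R (RDirProd_list (A # Rs'))"
    using iso by (auto simp: is_ring_iso_def A)
  then obtain f g where "ring_product R A (RDirProd_list Rs') f g"
    using ring_axioms cAB by (rule RDirProd_list_Cons_product)
  then interpret P: ring_product R A "RDirProd_list Rs'" f g .
  have K: "krull_like R" using KA KB by (rule P.krull_like)
  have "\<one>\<^bsub>A\<^esub> \<noteq> \<zero>\<^bsub>A\<^esub>"
    using Rs[of A] special_primary_ring_nontrivial domain.one_not_zero
    by (auto simp: A krull_domain_def)
  then have one: "\<one>\<^bsub>R\<^esub> \<noteq> \<zero>\<^bsub>R\<^esub>" using P.f.hom_one P.f.hom_zero by metis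
  have "acc_integral_u_ideals R"
    using K by (intro acc_integral_u_ideals_of_u_closed) (simp add: krull_like_def)
  then show ?thesis
    using K one krull_dim_TQ principal_ideal_ring_TQ
    by (simp add: krull_like_def u_noetherian_def)
qed

end
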